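(* Let $M$ and $N$ be atomic JBW$^*$-triples, and let $\Phi : \mathcal{U}_{min}(M) \to \mathcal{U}_{min}(N)$ be a bijective transformation preserving triple transition pseudo-probabilities, that is, $TTP(\Phi(e),\Phi(v)) = TTP(e,v)$ for all $e,v\in \mathcal{U}_{min}(M)$. Then $\Phi$ is an isometry with respect to the distances given by the triple norms, that is, $\|\Phi(e)-\Phi(v)\|=\|e-v\|$ for all $e,v\in\mathcal{U}_{min}(M)$.
   Context: A JB$^*$-triple is a complex Banach space $E$ with a continuous triple product $\{\cdot,\cdot,\cdot\}: E\times E\times E\to E$, symmetric and bilinear in the first and third variables and conjugate-linear in the middle one, such that, writing $L(a,b)x=\{a,b,x\}$: (a) $L(a,b)L(x,y)=L(x,y)L(a,b)+L(L(a,b)x,y)-L(x,L(b,a)y)$ for all $a,b,x,y\in E$; (b) $L(a,a)$ is a hermitian operator on the Banach space $E$ with non-negative spectrum for every $a\in E$; (c) $\|\{a,a,a\}\|=\|a\|^3$ for every $a\in E$. A tripotent is an element $e\in E$ with $\{e,e,e\}=e$. For a tripotent $e$, $E=E_0(e)\oplus E_1(e)\oplus E_2(e)$ with $E_k(e)=\{x\in E: L(e,e)x=\frac{k}{2}x\}$ (Peirce decomposition); $P_k(e)$ is the corresponding projection onto $E_k(e)$. A non-zero tripotent $e$ is minimal if $E_2(e)=\mathbb{C}e$; $\mathcal{U}_{min}(E)$ denotes the set of minimal tripotents. A JBW$^*$-triple is a JB$^*$-triple which is a dual Banach space; it has a unique isometric predual $M_*$ and its triple product is separately weak$^*$ continuous.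 It is atomic if it coincides with the weak$^*$-closure of the linear span of its minimal tripotents (equivalently, it is an $\ell_\infty$-sum of Cartan factors). For each minimal tripotent $e$ in a JBW$^*$-triple $M$ there is a unique extreme point $\varphi_e$ of the closed unit ball of $M_*$ with $\varphi_e(e)=1$, and $P_2(e)(x)=\varphi_e(x)e$ for all $x\in M$. For $e,v\in\mathcal{U}_{min}(M)$ the triple transition pseudo-probability from $e$ to $v$ is the complex number $TTP(e,v)=\varphi_v(e)$. *)

theory Defs
  imports "HOL-Analysis.Analysis"
begin

section \<open>Complex Banach spaces\<close>

class complex_banach = banach +
  fixes scaleC :: "complex \<Rightarrow> 'a \<Rightarrow> 'a"  (infixr \<open>*c\<close> 75)
  assumes scaleC_add_right: "a *c (x + y) = a *c x + a *c y"
    and scaleC_add_left: "(a + b) *c x = a *c x + b *c x"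
    and scaleC_scaleC: "a *c (b *c x) = (a * b) *c x"
    and scaleR_eq_scaleC: "scaleR r x = complex_of_real r *c x"
    and norm_scaleC: "norm (a *c x) = cmod a * norm x"

lemma scaleC_one: "1 *c x = (x :: 'a::complex_banach)"
  using scaleR_eq_scaleC [of 1 x] by simp

global_interpretation complex_vector:
  vector_space "scaleC :: complex \<Rightarrow> 'a \<Rightarrow> 'a::complex_banach"
  defines cspan = complex_vector.span
  by unfold_locales (simp_all add: scaleC_add_right scaleC_add_left scaleC_scaleC scaleC_one)

instantiation complex :: complex_banach
begin

definition "scaleC a x = a * (x :: complex)"

instance
  by standard (simp_all add: scaleC_complex_def algebra_simps scaleR_conv_of_real norm_mult)

end

definition bounded_clinear :: "('a::complex_banach \<Rightarrow> 'b::complex_banach) \<Rightarrow> bool" where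
  "bounded_clinear f \<longleftrightarrow> bounded_linear f \<and> (\<forall>c x. f (c *c x) = c *c f x)"

definition op_exp :: "('a::complex_banach \<Rightarrow> 'a) \<Rightarrow> 'a \<Rightarrow> 'a" where
  "op_exp f x = (\<Sum>n. (f ^^ n) x /\<^sub>R fact n)"

text \<open>
  An operator \<open>f\<close> is hermitian if \<open>exp (i t f)\<close> is isometric (on a non-zero space: of norm one)
  for all real \<open>t\<close>.
\<close>
definition hermitian_op :: "('a::complex_banach \<Rightarrow> 'a) \<Rightarrow> bool" where
  "hermitian_op f \<longleftrightarrow> bounded_clinear f \<and>
     (\<forall>(t::real) x. norm (op_exp (\<lambda>y. (\<i> * complex_of_real t) *c f y) x) = norm x)"

definition op_spectrum :: "('a::complex_banach \<Rightarrow> 'a) \<Rightarrow> complex set" where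
  "op_spectrum f = {z. \<not> (\<exists>g. bounded_clinear g \<and>
     (\<forall>x. g (z *c x - f x) = x) \<and> (\<forall>x. z *c g x - f (g x) = x))}"


section \<open>JB*-triples and JBW*-triples\<close>

locale jb_star_triple =
  fixes triple :: "'a::complex_banach \<Rightarrow> 'a \<Rightarrow> 'a \<Rightarrow> 'a"
  assumes triple_continuous: "continuous_on UNIV (\<lambda>(a, b, c). triple a b c)"
    and triple_commute: "triple a b c = triple c b a"
    and triple_add_left: "triple (a + a') b c = triple a b c + triple a' b c"
    and triple_scale_left: "triple (s *c a) b c = s *c triple a b c"
    and triple_add_middle: "triple a (b + b') c = triple a b c + triple a b' c"
    and triple_scale_middle: "triple a (s *c b) c = cnj s *c triple a b c"
    and jordan_identity:
      "triple a b (triple x y z) =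
       triple x y (triple a b z) + triple (triple a b x) y z - triple x (triple b a y) z"
    and hermitian: "hermitian_op (triple a a)"
    and spectrum_nonneg: "op_spectrum (triple a a) \<subseteq> complex_of_real ` {0..}"
    and norm_cube: "norm (triple a a a) = norm a ^ 3"

text \<open>
  A predual of \<open>'a\<close> is a complex Banach space \<open>'p\<close> together with an isometric complex-linear
  bijection \<open>J\<close> from \<open>'a\<close> onto the dual space of \<open>'p\<close>; \<open>J x p\<close> is the value of the
  functional \<open>p\<close> at \<open>x\<close>.  The type of bounded linear maps only asks for real linearity, hence
  the restriction to complex-linear functionals in the range.
\<close>
definition is_predual ::
    "('a::complex_banach \<Rightarrow> ('p::complex_banach \<Rightarrow>\<^sub>L complex)) \<Rightarrow> bool" where
  "is_predual J \<longleftrightarrow>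
     (\<forall>x y. J (x + y) = J x + J y) \<and>
     (\<forall>c x p. J (c *c x) p = c * J x p) \<and>
     (\<forall>x. norm (J x) = norm x) \<and>
     range J = {f. bounded_clinear (blinfun_apply f)}"

locale jbw_star_triple = jb_star_triple triple
  for triple :: "'a::complex_banach \<Rightarrow> 'a \<Rightarrow> 'a \<Rightarrow> 'a" +
  fixes J :: "'a \<Rightarrow> ('p::complex_banach \<Rightarrow>\<^sub>L complex)"
  assumes predual: "is_predual J"

text \<open>The topology of pointwise convergence on the predual.\<close>
definition weak_star_topology ::
    "('a::complex_banach \<Rightarrow> ('p::complex_banach \<Rightarrow>\<^sub>L complex)) \<Rightarrow> 'a topology" where
  "weak_star_topology J =
     pullback_topology UNIV (\<lambda>x. blinfun_apply (J x)) (product_topology (\<lambda>_. euclidean) UNIV)"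

definition tripotent :: "('a \<Rightarrow> 'a \<Rightarrow> 'a \<Rightarrow> 'a) \<Rightarrow> 'a \<Rightarrow> bool" where
  "tripotent triple e \<longleftrightarrow> triple e e e = e"

definition peirce_space ::
    "('a::complex_banach \<Rightarrow> 'a \<Rightarrow> 'a \<Rightarrow> 'a) \<Rightarrow> nat \<Rightarrow> 'a \<Rightarrow> 'a set" where
  "peirce_space triple k e = {x. triple e e x = (of_nat k / 2) *c x}"

definition min_tripotents :: "('a::complex_banach \<Rightarrow> 'a \<Rightarrow> 'a \<Rightarrow> 'a) \<Rightarrow> 'a set" where
  "min_tripotents triple =
     {e. tripotent triple e \<and> e \<noteq> 0 \<and> peirce_space triple 2 e = range (\<lambda>c. c *c e)}"

locale atomic_jbw_star_triple = jbw_star_triple triple J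
  for triple :: "'a::complex_banach \<Rightarrow> 'a \<Rightarrow> 'a \<Rightarrow> 'a"
    and J :: "'a \<Rightarrow> ('p::complex_banach \<Rightarrow>\<^sub>L complex)" +
  assumes atomic: "weak_star_topology J closure_of cspan (min_tripotents triple) = UNIV"

definition support_functional ::
    "('a::complex_banach \<Rightarrow> ('p::complex_banach \<Rightarrow>\<^sub>L complex)) \<Rightarrow> 'a \<Rightarrow> 'p" where
  "support_functional J e = (THE p. p extreme_point_of cball 0 1 \<and> J e p = 1)"

definition TTP ::
    "('a::complex_banach \<Rightarrow> ('p::complex_banach \<Rightarrow>\<^sub>L complex)) \<Rightarrow> 'a \<Rightarrow> 'a \<Rightarrow> complex" where
  "TTP J e v = J e (support_functional J v)"

end

theory Submission
  imports Defs
begin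

text \<open>
  Write \<open>Q x y\<close> for \<open>{x, y, x}\<close> and, for a minimal tripotent \<open>u\<close>, let \<open>coef u x\<close> be the scalar with
  \<open>P\<^sub>2(u) x = coef u x \<cdot> u\<close>.  The transition pseudo-probability from \<open>x\<close> to \<open>u\<close> is \<open>coef u x\<close>
  (\<open>TTP_eq_coef\<close>), and the theorem follows from the formula
  \<open>\<parallel>e - v\<parallel> = sup {\<bar>coef u e - coef u v\<bar> | u a minimal tripotent}\<close>: its right-hand side is expressed by
  transition pseudo-probabilities alone, so it is not changed by a bijection that preserves them.

  One inequality says that \<open>coef u\<close> is contractive.  It comes with the identification of the support
  functional.  A contractive functional \<open>f\<close> with \<open>f u\<close> close to \<open>1\<close> is small on both
  \<open>E\<^sub>0(u)\<close> and \<open>E\<^sub>1(u)\<close>, because \<open>\<parallel>u + x\<parallel> \<le> 1\<close> for \<open>x\<close> in the unit ball of \<open>E\<^sub>0(u)\<close> and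
  \<open>\<parallel>u + t x\<parallel> \<le> 1 + O(t\<^sup>2)\<close> for \<open>x\<close> in the unit ball of \<open>E\<^sub>1(u)\<close>; both estimates follow from
  \<open>\<parallel>{y, y, y}\<parallel> = \<parallel>y\<parallel>\<^sup>3\<close>.  So \<open>f\<close> is close in norm to \<open>coef u\<close> (\<open>almost_supporting_functional\<close>).
  Hence elements of the unit ball of the predual whose value at \<open>u\<close> tends to \<open>1\<close> form a Cauchy
  sequence, and the limit is the only element of the ball with value \<open>1\<close> at \<open>u\<close> (\<open>predual_coef\<close>).
  Norms in the predual are computed from its dual by the Hahn-Banach theorem.

  The other inequality (\<open>coef_almost_norms_diff\<close>) is algebraic.  Let \<open>x = e - v\<close>,
  \<open>\<alpha> = coef v e\<close> and \<open>m = coef v {e, e, v}\<close>.  The Jordan identity and minimality show that the span of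
  \<open>e\<close>, \<open>v\<close>, \<open>{e, e, v}\<close>, \<open>{v, v, e}\<close> is invariant under \<open>Q x\<close>, which acts there by a matrix in
  \<open>\<alpha>\<close> and \<open>m\<close> (\<open>Q_diff_comb\<close>).  The model is that of two rank-one matrices, where \<open>x\<close> has rank at most two
  and two squared singular values \<open>t\<close>, \<open>t'\<close>; accordingly
  \<open>x\<^sup>5 = (t + t') x\<^sup>3 - t t' x\<close> for odd powers in the triple sense, with
  \<open>t + t' = 2 - 2 Re \<alpha>\<close> and \<open>t t' = 1 + \<bar>\<alpha>\<bar>\<^sup>2 - 2 m\<close>.  The numbers \<open>t\<close> and \<open>t'\<close> are real, since otherwise
  \<open>{x, x, _}\<close> would have a non-real eigenvalue (\<open>discr_nonneg\<close>).  If \<open>t > t'\<close>, then \<open>y = x\<^sup>3 - t' x\<close> is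
  the part of \<open>x\<close> for the larger singular value.  Since \<open>Q y e\<close> is a non-zero multiple of \<open>y\<close>, and
  \<open>Q y\<close> maps rank-one elements to rank-one elements by the fundamental formula
  \<open>Q (Q x y) = Q x (Q y (Q x _))\<close>, the element \<open>y\<close> is a positive multiple of a minimal tripotent \<open>u\<close>.  From
  \<open>Q x u = t u\<close> follows \<open>\<bar>coef u x\<bar>\<^sup>2 = t\<close>, and iterated cubes of \<open>x\<close> give \<open>\<parallel>x\<parallel>\<^sup>2 \<le> t\<close>.  If \<open>t = t'\<close>, then
  \<open>e\<close> and \<open>v\<close> are orthogonal or \<open>e\<close> is a limit of multiples \<open>c e\<close> with \<open>\<bar>c\<bar> = 1\<close> for which the two
  values differ.
\<close>


section \<open>Norming functionals\<close>

text \<open>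
  Homogeneity is required as an inequality only; \<open>sublinear_scale\<close> recovers the equality.
\<close>
definition sublinear :: "('a::real_normed_vector \<Rightarrow> real) \<Rightarrow> bool" where
  "sublinear q \<longleftrightarrow> (\<forall>x y. q (x + y) \<le> q x + q y) \<and> (\<forall>t>0. \<forall>x. q (t *\<^sub>R x) \<le> t * q x)"

lemma sublinear_add: "sublinear q \<Longrightarrow> q (x + y) \<le> q x + q y"
  by (simp add: sublinear_def)

lemma sublinear_scale:
  assumes "sublinear q" "t \<ge> 0"
  shows "q (t *\<^sub>R x) = t * q x"
proof (cases "t = 0")
  case True
  have "q 0 \<le> q 0 + q 0" using sublinear_add [OF assms(1), of 0 0] by simp
  moreover have "q ((1/2) *\<^sub>R 0) \<le> (1/2) * q 0"
    using assms(1) unfolding sublinear_def by (metis half_gt_zero zero_less_one)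
  ultimately show ?thesis using True by simp
next
  case False
  then have t: "t > 0" using assms(2) by simp
  have "q x = q (inverse t *\<^sub>R (t *\<^sub>R x))" using False by simp
  also have "\<dots> \<le> inverse t * q (t *\<^sub>R x)"
    using assms(1) t unfolding sublinear_def by (metis inverse_positive_iff_positive)
  finally have "t * q x \<le> q (t *\<^sub>R x)" using t by (simp add: field_simps)
  moreover have "q (t *\<^sub>R x) \<le> t * q x" using assms(1) t by (simp add: sublinear_def)
  ultimately show ?thesis by simp
qed

lemma sublinear_uminus:
  assumes "sublinear q"
  shows "- q (- x) \<le> q x"
  using sublinear_add [OF assms, of x "- x"] sublinear_scale [OF assms, of 0 x] by simp

lemma sublinear_norm: "sublinear (norm :: 'a::real_normed_vector \<Rightarrow> real)"
  by (simp add: sublinear_def norm_triangle_ineq)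

text \<open>
  The largest sublinear function below \<open>q\<close> whose value at \<open>- y\<close> is at most \<open>- q y\<close>.  Its existence shows that a
  minimal sublinear function is additive, and for \<open>q = norm\<close> it makes the functional attain its norm at \<open>y\<close>.
\<close>
definition tilt :: "('a::real_normed_vector \<Rightarrow> real) \<Rightarrow> 'a \<Rightarrow> 'a \<Rightarrow> real" where
  "tilt q y x = (INF t\<in>{0..}. q (x + t *\<^sub>R y) - t * q y)"

lemma tilt_le:
  assumes "sublinear q" "t \<ge> 0"
  shows "tilt q y x \<le> q (x + t *\<^sub>R y) - t * q y"
  unfolding tilt_def
proof (rule cINF_lower)
  have "- q (- x) \<le> q (x + s *\<^sub>R y) - s * q y" if "s \<ge> 0" for s
    using sublinear_add [OF assms(1), of "x + s *\<^sub>R y" "- x"] sublinear_scale [OF assms(1) that, of y]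
    by simp
  then show "bdd_below ((\<lambda>t. q (x + t *\<^sub>R y) - t * q y) ` {0..})"
    by (intro bdd_belowI2 [where m = "- q (- x)"]) auto
qed (use assms in auto)

lemma sublinear_tilt:
  assumes "sublinear q"
  shows "sublinear (tilt q y)"
  unfolding sublinear_def
proof (intro conjI allI impI)
  fix x x'
  have *: "tilt q y (x + x') \<le> (q (x + s *\<^sub>R y) - s * q y) + (q (x' + t *\<^sub>R y) - t * q y)"
    if "s \<ge> 0" "t \<ge> 0" for s t
    using tilt_le [OF assms, of "s + t" y "x + x'"] that
      sublinear_add [OF assms, of "x + s *\<^sub>R y" "x' + t *\<^sub>R y"]
    by (simp add: algebra_simps)
  have "tilt q y (x + x') - (q (x + s *\<^sub>R y) - s * q y) \<le> tilt q y x'" if "s \<ge> 0" for s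
    unfolding tilt_def [of q y x'] by (rule cINF_greatest) (use * [OF that] in \<open>auto simp: algebra_simps\<close>)
  then have "tilt q y (x + x') - tilt q y x' \<le> tilt q y x"
    unfolding tilt_def [of q y x] by (intro cINF_greatest) (auto simp: algebra_simps)
  then show "tilt q y (x + x') \<le> tilt q y x + tilt q y x'" by simp
next
  fix t :: real and x assume t: "t > 0"
  have "inverse t * tilt q y (t *\<^sub>R x) \<le> q (x + s *\<^sub>R y) - s * q y" if s: "s \<ge> 0" for s
  proof -
    have "tilt q y (t *\<^sub>R x) \<le> q (t *\<^sub>R (x + s *\<^sub>R y)) - (t * s) * q y"
      using tilt_le [OF assms, of "t * s" y "t *\<^sub>R x"] s t by (simp add: algebra_simps)
    then show ?thesis using t sublinear_scale [OF assms, of t "x + s *\<^sub>R y"] by (simp add: field_simps)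
  qed
  then have "inverse t * tilt q y (t *\<^sub>R x) \<le> tilt q y x"
    unfolding tilt_def [of q y x] by (intro cINF_greatest) auto
  then show "tilt q y (t *\<^sub>R x) \<le> t * tilt q y x" using t by (simp add: field_simps)
qed

text \<open>
  Zorn's lemma applies since the pointwise infimum of a chain is finite, being bounded below by
  \<open>- q0 (- x)\<close>, and it is again sublinear: two members of a chain have a common lower bound among
  them.
\<close>
lemma minimal_sublinear_below:
  assumes "sublinear (q0 :: 'a::real_normed_vector \<Rightarrow> real)"
  obtains q where "sublinear q" "q \<le> q0" "\<And>p. sublinear p \<Longrightarrow> p \<le> q \<Longrightarrow> p = q"
proof -
  let ?A = "{q. sublinear q \<and> q \<le> q0}"
  have "\<exists>m\<in>?A. \<forall>a\<in>?A. m \<ge> a \<longrightarrow> a = m"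
  proof (rule predicate_Zorn)
    show "partial_order_on ?A (relation_of (\<ge>) ?A)"
      by (auto intro: partial_order_on_relation_ofI)
  next
    fix C assume C: "C \<in> Chains (relation_of (\<ge>) ?A)"
    then have CA: "q \<in> ?A" if "q \<in> C" for q
      using that unfolding Chains_def relation_of_def by blast
    have tot: "p \<le> q \<or> q \<le> p" if "p \<in> C" "q \<in> C" for p q
      using that C unfolding Chains_def relation_of_def by blast
    show "\<exists>u\<in>?A. \<forall>a\<in>C. a \<ge> u"
    proof (cases "C = {}")
      case True
      then show ?thesis using assms by blast
    next
      case False
      define u where "u = (\<lambda>x. INF q\<in>C. q x)"
      have u_le: "u x \<le> q x" if "q \<in> C" for q x
        unfolding u_def
      proof (rule cINF_lower [OF _ that])
        have "- q0 (- x) \<le> p x" if "p \<in> C" for p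
          using CA [OF that] sublinear_uminus [of p x] by (auto dest!: le_funD [of p q0 "- x"])
        then show "bdd_below ((\<lambda>q. q x) ` C)" by (intro bdd_belowI2) auto
      qed
      have u_greatest: "m \<le> u x" if "\<And>q. q \<in> C \<Longrightarrow> m \<le> q x" for m x
        unfolding u_def using False that by (intro cINF_greatest)
      have sub: "u (x + y) \<le> p x + q y" if pq: "p \<in> C" "q \<in> C" for x y p q
      proof -
        obtain r where "r \<in> C" "r \<le> p" "r \<le> q" using tot [OF pq] pq by blast
        then show ?thesis
          using u_le [of r "x + y"] CA [of r] sublinear_add [of r x y]
            le_funD [of r p x] le_funD [of r q y] by fastforce
      qed
      have "u (x + y) - p x \<le> u y" if "p \<in> C" for x y p
        using sub [OF that] by (intro u_greatest) (simp add: algebra_simps)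
      then have "u (x + y) - u y \<le> u x" for x y
        by (intro u_greatest) (auto simp: algebra_simps)
      then have 1: "u (x + y) \<le> u x + u y" for x y by (simp add: algebra_simps)
      have 2: "u (t *\<^sub>R x) \<le> t * u x" if "t > 0" for t x
      proof -
        have "inverse t * u (t *\<^sub>R x) \<le> q x" if "q \<in> C" for q
          using u_le [OF that, of "t *\<^sub>R x"] CA [OF that] sublinear_scale [of q t x] \<open>t > 0\<close>
          by (auto simp: field_simps)
        then show ?thesis using u_greatest [of "inverse t * u (t *\<^sub>R x)" x] that by (simp add: field_simps)
      qed
      have "u \<le> q0" using False CA u_le by (fastforce simp: le_fun_def intro: order_trans)
      then have "u \<in> ?A" using 1 2 by (simp add: sublinear_def)
      then show ?thesis using u_le by (auto simp: le_fun_def)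
    qed
  qed
  then obtain m where m: "m \<in> ?A" "\<And>a. a \<in> ?A \<Longrightarrow> a \<le> m \<Longrightarrow> a = m" by blast
  show thesis
    by (rule that [of m]) (use m in \<open>auto intro: order_trans\<close>)
qed

text \<open>
  By minimality tilting does not change \<open>q\<close>, so \<open>q x \<le> q (x + y) - q y\<close>, which is the
  converse of subadditivity.
\<close>
lemma linear_minimal_sublinear:
  assumes q: "sublinear q" and min: "\<And>p. sublinear p \<Longrightarrow> p \<le> q \<Longrightarrow> p = q"
  shows "linear q"
proof -
  have "tilt q y = q" for y
    by (rule min) (use tilt_le [OF q, of 0] sublinear_tilt [OF q] in \<open>auto simp: le_fun_def\<close>)
  then have "q x \<le> q (x + y) - q y" for x y
    using tilt_le [OF q, of 1 y x] by simp
  then have add: "q (x + y) = q x + q y" for x y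
    using sublinear_add [OF q, of x y] by (smt (verit, best))
  have neg: "q (- x) = - q x" for x
    using add [of x "- x"] sublinear_scale [OF q, of 0 x] by simp
  have "q (t *\<^sub>R x) = t * q x" for t x
    using sublinear_scale [OF q, of t x] sublinear_scale [OF q, of "- t" x] neg [of "t *\<^sub>R x"]
    by (cases "t \<ge> 0") auto
  with add show ?thesis by (intro linearI) auto
qed

text \<open>
  Any linear functional below the norm tilted at \<open>p\<close> has value at most \<open>- norm p\<close> at \<open>- p\<close>.
\<close>
lemma real_norming_functional:
  fixes p :: "'a::real_normed_vector"
  obtains f where "linear f" "\<And>x. f x \<le> norm x" "f p = norm p"
proof -
  obtain f where f: "sublinear f" "f \<le> tilt norm p" "\<And>g. sublinear g \<Longrightarrow> g \<le> f \<Longrightarrow> g = f"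
    using minimal_sublinear_below [OF sublinear_tilt [OF sublinear_norm]] by blast
  have lin: "linear f" using linear_minimal_sublinear f by blast
  have le: "f x \<le> norm (x + t *\<^sub>R p) - t * norm p" if "t \<ge> 0" for x t
    using le_funD [OF f(2), of x] tilt_le [OF sublinear_norm that, of p x] by linarith
  have "f (- p) \<le> - norm p" using le [of 1 "- p"] by simp
  then have "f p \<ge> norm p" using linear_neg [OF lin, of p] by simp
  then show thesis using that [OF lin] le [of 0] by (metis add.right_neutral add_0 antisym diff_zero
        le le_numeral_extra(3) mult_zero_left scaleR_zero_left)
qed

lemma unimodular_rotation:
  obtains c where "cmod c = 1" "c * z = complex_of_real (cmod z)"
proof (cases "z = 0")
  case False
  then have "cnj z / cmod z * z = cmod z"
    using complex_norm_square [of z] by (simp add: field_simps power2_eq_square)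
  then show thesis using that [of "cnj z / cmod z"] False by (simp add: norm_divide)
qed (use that [of 1] in simp)

text \<open>
  The complex functional is determined by its real part \<open>g\<close> as \<open>g x - \<i> g (\<i> x)\<close>.
\<close>
lemma norming_functional:
  fixes p :: "'a::complex_banach"
  obtains f :: "'a \<Rightarrow>\<^sub>L complex"
  where "bounded_clinear (blinfun_apply f)" "\<And>x. cmod (f x) \<le> norm x" "f p = norm p"
proof -
  obtain g where lin: "linear g" and le: "\<And>x. g x \<le> norm x" and p: "g p = norm p"
    using real_norming_functional by blast
  define f where "f x = Complex (g x) (- g (\<i> *c x))" for x
  have sc: "g (r *\<^sub>R x) = r * g x" for r x using linear_scale [OF lin, of r x] by simp
  have add: "g (x + y) = g x + g y" for x y using linear_add [OF lin] .
  have cs: "f (c *c x) = c * f x" for c x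
  proof -
    have re: "g (c *c x) = Re c * g x + Im c * g (\<i> *c x)" for c x
    proof -
      have "c *c x = Re c *\<^sub>R x + Im c *\<^sub>R (\<i> *c x)"
        by (simp add: scaleR_eq_scaleC scaleC_scaleC flip: scaleC_add_left)
           (metis complex_eq mult.commute)
      then show ?thesis by (simp add: add sc)
    qed
    have "\<i> *c (c *c x) = (\<i> * c) *c x" by (simp add: scaleC_scaleC)
    then show ?thesis by (simp add: f_def complex_eq_iff re [of c] re [of "\<i> * c"])
  qed
  have fadd: "f (x + y) = f x + f y" for x y
    by (simp add: f_def add scaleC_add_right complex_eq_iff)
  have bound: "cmod (f x) \<le> norm x" for x
  proof -
    obtain c where c: "cmod c = 1" "c * f x = cmod (f x)" by (rule unimodular_rotation)
    then have "cmod (f x) = Re (f (c *c x))" by (simp add: cs)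
    also have "\<dots> \<le> norm (c *c x)" by (simp add: f_def le)
    finally show ?thesis by (simp add: norm_scaleC c)
  qed
  have "bounded_linear f"
    by (rule bounded_linear_intro [where K = 1])
       (simp_all add: fadd scaleR_eq_scaleC [where 'a = 'a] cs scaleR_conv_of_real bound)
  then have ap: "blinfun_apply (Blinfun f) = f" by (rule bounded_linear_Blinfun_apply)
  have "Re (f p) = norm p" by (simp add: f_def p)
  moreover have "(Im (f p))\<^sup>2 \<le> 0"
    using bound [of p] power_mono [of "cmod (f p)" "norm p" 2] calculation cmod_power2 [of "f p"] by simp
  ultimately have "f p = norm p" by (simp add: complex_eq_iff)
  then show thesis
    using \<open>bounded_linear f\<close> by (intro that [of "Blinfun f"]) (simp_all add: ap bounded_clinear_def scaleC_complex_def cs bound)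
qed

section \<open>Jordan identities and Peirce decomposition\<close>

text \<open>
  The two equations give \<open>a - b = 2 (b - a)\<close>.  The Jordan identity, applied to two arrangements of the same
  elements, often produces such a pair.
\<close>
lemma eq_if_mutual_reflection:
  fixes a b c :: "'a::real_vector"
  assumes "a = b + b - c" "b = a + a - c"
  shows "a = b"
proof -
  have "(1 + 1 + 1 :: real) *\<^sub>R (a - b) = (a - (b + b - c)) - (b - (a + a - c))"
    unfolding scaleR_left_distrib scaleR_one by simp
  also have "\<dots> = 0" using assms by simp
  finally show ?thesis by simp
qed

lemma double_cancel: "a + a = b + b \<Longrightarrow> a = (b::'a::real_vector)"
  by (metis scaleR_2 scaleR_cancel_left zero_neq_numeral)

lemma double_eq_zero: "a + a = 0 \<Longrightarrow> a = (0::'a::real_vector)"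
  using double_cancel [of a 0] by simp

lemma scaleC_zero_left [simp]: "0 *c x = (0::'a::complex_banach)"
  by (rule complex_vector.scale_zero_left)

lemma scaleC_zero_right [simp]: "c *c 0 = (0::'a::complex_banach)"
  by (rule complex_vector.scale_zero_right)

declare scaleC_one [simp]

lemmas scaleC_simps = scaleC_add_left scaleC_add_right scaleC_scaleC
  complex_vector.scale_left_diff_distrib complex_vector.scale_right_diff_distrib
  complex_vector.scale_minus_left complex_vector.scale_minus_right

lemma scaleC_numeral_double: "2 *c x = x + (x::'a::complex_banach)"
  using scaleC_add_left [of 1 1 x] by simp

context jb_star_triple
begin

lemma triple_add_right: "triple a b (c + c') = triple a b c + triple a b c'"
  by (metis triple_add_left triple_commute)

lemma triple_scale_right: "triple a b (s *c c) = s *c triple a b c"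
  by (metis triple_scale_left triple_commute)

lemma triple_zero [simp]: "triple 0 b c = 0" "triple a 0 c = 0" "triple a b 0 = 0"
  using triple_scale_left [of 0 0] triple_scale_middle [of _ 0 0] triple_scale_right [of _ _ 0 0] by auto

lemma triple_minus:
  "triple (- a) b c = - triple a b c" "triple a (- b) c = - triple a b c"
  "triple a b (- c) = - triple a b c"
  using triple_scale_left [of "-1" a] triple_scale_middle [of a "-1" b]
    triple_scale_right [of a b "-1" c] by (simp_all add: complex_vector.scale_minus_left)

lemma triple_diff:
  "triple (a - a') b c = triple a b c - triple a' b c"
  "triple a (b - b') c = triple a b c - triple a b' c"
  "triple a b (c - c') = triple a b c - triple a b c'"
  using triple_add_left [of a "- a'"] triple_add_middle [of a b "- b'"]
    triple_add_right [of a b c "- c'"] by (simp_all add: triple_minus)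

lemmas triple_expand = triple_add_left triple_add_middle triple_add_right triple_diff triple_minus
  triple_scale_left triple_scale_middle triple_scale_right

abbreviation Q :: "'a \<Rightarrow> 'a \<Rightarrow> 'a" where "Q x y \<equiv> triple x y x"

text \<open>
  The Jordan identity expresses each of \<open>{x, y, Q x z}\<close> and \<open>{x, z, Q x y}\<close> by the other one.
\<close>
lemma triple_quadratic: "triple x y (Q x z) = Q x (triple y x z)"
proof -
  have A: "triple x y (Q x z) = triple x z (Q x y) + triple x z (Q x y) - Q x (triple y x z)"
    using jordan_identity [of x y x z x] triple_commute [of "Q x y" z x] by simp
  have B: "triple x z (Q x y) = triple x y (Q x z) + triple x y (Q x z) - Q x (triple y x z)"
    using jordan_identity [of x z x y x] triple_commute [of "Q x z" y x] triple_commute [of z x y]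
    by simp
  have "triple x y (Q x z) = triple x z (Q x y)" using A B by (rule eq_if_mutual_reflection)
  then show ?thesis using A by (simp add: algebra_simps)
qed

lemma triple_quadratic_middle: "triple z (Q x y) y = triple (Q y x) x z"
  using jordan_identity [of y x y x z] triple_commute [of z "Q x y" y] by simp

text \<open>
  Expanding \<open>Q (Q x y) z\<close> at the last argument \<open>Q x y = {x, y, x}\<close> leaves terms of the form \<open>Q x _\<close>; the
  terms inside \<open>Q x\<close> are exactly those of the Jordan identity for \<open>{z, x, Q y x}\<close>.
\<close>
lemma fundamental_formula: "Q (Q x y) z = Q x (Q y (Q x z))"
proof -
  let ?u = "Q x y"
  have 1: "triple ?u z x = Q x (triple y x z)"
    using triple_quadratic [of x z y] by (metis triple_commute)
  have "Q ?u z = triple (triple ?u z x) y x + triple x y (triple ?u z x) - Q x (triple z ?u y)"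
    using jordan_identity [of ?u z x y x] by (simp add: algebra_simps)
  also have "\<dots> = triple x y (Q x (triple y x z)) + triple x y (Q x (triple y x z)) - Q x (triple z ?u y)"
    by (simp add: 1 triple_commute [of "Q x (triple y x z)" y x])
  also have "\<dots> = Q x (triple y x (triple y x z) + triple y x (triple y x z) - triple z ?u y)"
    by (simp add: triple_quadratic triple_expand)
  also have "triple z ?u y = triple (Q y x) x z"
    by (rule triple_quadratic_middle)
  also have "triple y x (triple y x z) + triple y x (triple y x z) - triple (Q y x) x z = Q y (Q x z)"
    using jordan_identity [of z x y x y] triple_commute [of z x "Q y x"] triple_commute [of z x y]
      triple_commute [of "triple y x z" x y]
    by (simp add: algebra_simps)
  finally show ?thesis .
qed

lemma Q_power_fundamental:
  "Q (((Q x) ^^ k) x) z = ((Q x) ^^ (2 * k + 1)) z"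
proof (induction k arbitrary: z)
  case (Suc k)
  have "Q (((Q x) ^^ Suc k) x) z = Q x (Q (((Q x) ^^ k) x) (Q x z))"
    by (simp add: fundamental_formula)
  also have "\<dots> = Q x (((Q x) ^^ (2 * k + 1)) (Q x z))" by (simp only: Suc)
  also have "\<dots> = ((Q x) ^^ (2 * Suc k + 1)) z" by (simp add: funpow_swap1 [of "Q x"])
  finally show ?case .
qed simp

context
  fixes e :: 'a
  assumes e: "triple e e e = e"
begin

text \<open>
  The eigenspaces of \<open>{e, e, _}\<close> are obtained from \<open>Q e\<close>: it is annihilated by \<open>{e, e, _} - 1\<close> on both
  sides, and its square is the polynomial \<open>2 L\<^sup>2 - L\<close> in \<open>L = {e, e, _}\<close>.  Together they give the cubic equation
  \<open>L (2 L - 1) (L - 1) = 0\<close>.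
\<close>
lemma Peirce_L_Q: "triple e e (Q e x) = Q e x"
  and Peirce_Q_L: "Q e (triple e e x) = Q e x"
proof -
  have 1: "triple e e (Q e x) = Q e x + Q e x - Q e (triple e e x)"
    using jordan_identity [of e e e x e] by (simp add: e)
  have 2: "Q e x = triple e e (Q e x) + triple e e (Q e x) - Q e (triple e e x)"
    using jordan_identity [of e x e e e] triple_commute [of "Q e x" e e] triple_commute [of x e e] by (simp add: e)
  show "triple e e (Q e x) = Q e x" using 1 2 by (rule eq_if_mutual_reflection)
  with 1 show "Q e (triple e e x) = Q e x" by (simp add: algebra_simps)
qed

lemma Peirce_Q_Q: "Q e (Q e x) = triple e e (triple e e x) + triple e e (triple e e x) - triple e e x"
  using jordan_identity [of x e e e e] triple_commute [of x e e] triple_commute [of "triple e e x" e e]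
  by (simp add: e algebra_simps)

lemma Peirce_cubic:
  "triple e e (triple e e (triple e e x)) + triple e e (triple e e (triple e e x)) =
   triple e e (triple e e x) + triple e e (triple e e x) + triple e e (triple e e x) - triple e e x"
  using Peirce_L_Q [of "Q e x"] by (simp add: Peirce_Q_Q triple_expand algebra_simps)

text \<open>
  For \<open>T = {e, x, _}\<close> the commutator of \<open>L = {e, e, _}\<close> and \<open>T\<close> can be computed from either factor:
  one way it is \<open>T\<close>, the other way it vanishes.  The same happens with \<open>{x, e, _}\<close>, up to sign.
\<close>
lemma Peirce_0_orthogonal:
  assumes x: "triple e e x = 0"
  shows "triple e x z = 0" "triple x e z = 0"
proof -
  have Qx: "Q e x = 0" using Peirce_Q_L [of x] x by simp
  have xee: "triple x e e = 0" using x triple_commute by metis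
  show "triple e x z = 0"
    using jordan_identity [of e e e x z] jordan_identity [of e x e e z] by (simp add: e x Qx xee)
  show "triple x e z = 0"
    using jordan_identity [of e e x e z] jordan_identity [of x e e e z] by (simp add: e x Qx xee)
qed

lemma Peirce_1_Q:
  assumes x: "triple e e x = (1/2) *c x"
  shows "Q e x = 0"
proof -
  have "(1/2) *c Q e x = Q e x" using Peirce_Q_L [of x] by (simp add: x triple_expand)
  then have "(1 - 1/2) *c Q e x = 0" unfolding complex_vector.scale_left_diff_distrib by simp
  then show ?thesis unfolding complex_vector.scale_eq_0_iff by simp
qed

text \<open>
  The three summands are the Lagrange interpolation polynomials in \<open>{e, e, _}\<close> for its possible
  eigenvalues \<open>1\<close>, \<open>1/2\<close> and \<open>0\<close>.
\<close>
lemma Peirce_decomposition: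
  obtains x1 x0 where "x = Q e (Q e x) + x1 + x0" "triple e e x1 = (1/2) *c x1" "triple e e x0 = 0"
    "x1 = 4 *c (triple e e x - triple e e (triple e e x))"
proof -
  let ?L = "triple e e"
  define x1 where "x1 = 4 *c (?L x - ?L (?L x))"
  define x0 where "x0 = x - 3 *c ?L x + 2 *c ?L (?L x)"
  have c: "2 *c ?L (?L (?L x)) = 3 *c ?L (?L x) - ?L x"
    using Peirce_cubic [of x] scaleC_add_left [of 2 1 "?L (?L x)"]
    by (simp add: scaleC_numeral_double)
  have "x = Q e (Q e x) + x1 + x0"
    using scaleC_add_left [of 3 1 "?L x"] scaleC_add_left [of 2 2 "?L (?L x)"]
    by (simp add: Peirce_Q_Q x1_def x0_def scaleC_simps) (simp add: scaleC_numeral_double)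
  moreover have "?L x0 = 0"
    using c scaleC_add_left [of 2 1 "?L (?L x)"] by (simp add: x0_def triple_expand)
  moreover have "?L x1 = (1/2) *c x1"
  proof -
    have "?L x1 = 4 *c ?L (?L x) - 2 *c (2 *c ?L (?L (?L x)))"
      by (simp add: x1_def triple_expand scaleC_simps)
    also have "\<dots> = (4 - 6) *c ?L (?L x) + 2 *c ?L x"
      unfolding c complex_vector.scale_left_diff_distrib by (simp add: scaleC_simps)
    finally show ?thesis by (simp add: x1_def scaleC_simps)
  qed
  ultimately show thesis using that x1_def by blast
qed

end

end

section \<open>Norm estimates and minimal tripotents\<close>

context jb_star_triple
begin

lemma triple_scaleR:
  "triple (r *\<^sub>R a) b c = r *\<^sub>R triple a b c" "triple a (r *\<^sub>R b) c = r *\<^sub>R triple a b c"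
  "triple a b (r *\<^sub>R c) = r *\<^sub>R triple a b c"
  by (simp_all add: scaleR_eq_scaleC triple_expand)

text \<open>
  A real-trilinear map that is continuous at the origin is bounded, by scaling.
\<close>
lemma triple_bounded:
  obtains K where "K \<ge> 0" "\<And>a b c. norm (triple a b c) \<le> K * norm a * norm b * norm c"
proof -
  let ?f = "\<lambda>(a, b, c). triple a b c"
  have "isCont ?f (0, 0, 0)"
    using triple_continuous by (simp add: continuous_on_eq_continuous_at)
  then obtain d where d: "d > 0" and *: "\<And>p. dist p (0, 0, 0) < d \<Longrightarrow> dist (?f p) (?f (0, 0, 0)) < 1"
    unfolding continuous_at_eps_delta by (metis zero_less_one)
  have small: "norm (triple a b c) \<le> 1" if "norm a = d / 4" "norm b = d / 4" "norm c = d / 4" for a b c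
  proof -
    have "norm (a, b, c) \<le> norm a + (norm b + norm c)"
      unfolding norm_Pair using sqrt_sum_squares_le_sum_abs [of "norm a"] sqrt_sum_squares_le_sum_abs [of "norm b" "norm c"]
      by (smt (verit) norm_ge_zero real_sqrt_ge_0_iff zero_le_power2 sum_power2_ge_zero real_sqrt_le_iff)
    then have "dist (a, b, c) (0, 0, 0) < d" using that d by (simp add: dist_norm)
    from * [OF this] show ?thesis by (simp add: dist_norm)
  qed
  have "norm (triple a b c) \<le> (4 / d) ^ 3 * norm a * norm b * norm c" for a b c
  proof (cases "a = 0 \<or> b = 0 \<or> c = 0")
    case False
    define k where "k x = d / (4 * norm x)" for x :: 'a
    have "norm (triple (k a *\<^sub>R a) (k b *\<^sub>R b) (k c *\<^sub>R c)) \<le> 1"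
      using False d by (intro small) (simp_all add: k_def)
    moreover have "\<bar>k x\<bar> = k x" for x using d by (simp add: k_def)
    ultimately have le: "k a * k b * k c * norm (triple a b c) \<le> 1"
      by (simp add: triple_scaleR abs_mult mult_ac)
    define p where "p = norm a * norm b * norm c"
    have k: "k a * k b * k c = (d / 4) ^ 3 / p"
      by (simp add: k_def p_def power3_eq_cube)
    have p: "p > 0" using False by (simp add: p_def)
    have "norm (triple a b c) \<le> (4 / d) ^ 3 * p"
      using d p le unfolding k by (simp add: field_simps power_divide)
    then show ?thesis by (simp add: p_def mult.assoc)
  qed auto
  then show thesis using that [of "(4 / d) ^ 3"] d by simp
qed

lemma tripotent_norm:
  assumes "triple e e e = e" "e \<noteq> 0"
  shows "norm e = 1"
proof -
  have "norm e ^ 3 = norm e" using norm_cube [of e] assms by simp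
  then have "norm e ^ 2 = 1" using assms by (simp add: power3_eq_cube power2_eq_square)
  then show ?thesis by (simp add: power2_eq_1_iff) (metis norm_ge_zero neg_0_le_iff_le not_one_le_zero)
qed

definition cube :: "'a \<Rightarrow> 'a" where "cube x = triple x x x"

lemma norm_cube_iterate: "norm ((cube ^^ n) x) = norm x ^ (3 ^ n)"
  by (induction n) (simp_all add: cube_def norm_cube power_mult [symmetric] mult.commute)

text \<open>
  Since the norm of the \<open>n\<close>-th iterated cube of \<open>x\<close> is \<open>\<parallel>x\<parallel>\<close> to the power \<open>3\<^sup>n\<close>, bounds up to constants on the
  iterated cubes become sharp bounds on \<open>x\<close>.
\<close>
lemma norm_le_if_cubes_bounded:
  assumes "\<And>n. norm ((cube ^^ n) x) \<le> C * r ^ (3 ^ n)" "r \<ge> 0"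
  shows "norm x \<le> r"
proof (rule ccontr)
  assume "\<not> norm x \<le> r"
  then have lt: "r < norm x" by simp
  then have pos: "norm x > 0" using assms(2) by linarith
  show False
  proof (cases "r = 0")
    case True
    then show False using assms(1) [of 0] pos by simp
  next
    case False
    then have r: "r > 0" using assms(2) by simp
    have "1 < norm x / r" using lt r by simp
    then obtain n where n: "C < (norm x / r) ^ n" using real_arch_pow by blast
    have "n \<le> 3 ^ n"
      using less_exp [of n] power_mono [of 2 "3::nat" n] by simp
    then have "(norm x / r) ^ n \<le> (norm x / r) ^ (3 ^ n)"
      using \<open>1 < norm x / r\<close> by (intro power_increasing) auto
    also have "\<dots> \<le> C"
      using assms(1) [of n] r by (simp add: norm_cube_iterate power_divide field_simps)
    finally show False using n by simp
  qed
qed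

text \<open>
  Cubing acts separately on the two orthogonal summands and fixes \<open>e\<close>, so the iterated cubes stay bounded
  by \<open>2\<close>.
\<close>
lemma norm_add_orthogonal_le:
  assumes e: "triple e e e = e" "e \<noteq> 0" and x: "triple e e x = 0" and le: "norm x \<le> 1"
  shows "norm (e + x) \<le> 1"
proof (rule norm_le_if_cubes_bounded [where C = 2])
  fix n
  have iter: "(cube ^^ n) (e + x) = e + (cube ^^ n) x \<and> triple e e ((cube ^^ n) x) = 0"
  proof (induction n)
    case (Suc n)
    have "cube (e + z) = e + cube z \<and> triple e e (cube z) = 0" if z: "triple e e z = 0" for z
    proof -
      have "triple e z y = 0" "triple z e y = 0" "triple y z e = 0" "triple z e e = 0" for y
        using Peirce_0_orthogonal [OF e(1) z] triple_commute by metis+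
      moreover have "triple e e (Q z z) = 0"
        using jordan_identity [of e e z z z] z by simp
      ultimately show ?thesis by (simp add: cube_def triple_expand z e)
    qed
    then show ?case using Suc by simp
  qed (simp add: x)
  have "norm ((cube ^^ n) x) \<le> 1" using le by (simp add: norm_cube_iterate power_le_one)
  then show "norm ((cube ^^ n) (e + x)) \<le> 2 * 1 ^ (3 ^ n)"
    using norm_triangle_ineq [of e "(cube ^^ n) x"] tripotent_norm [OF e] iter by simp
qed simp

text \<open>
  The cube of \<open>y = e + t x\<close> is \<open>y + O(t\<^sup>2)\<close>, because \<open>2 {e, e, x} + {e, x, e} = x\<close> for \<open>x\<close> in \<open>E\<^sub>1(e)\<close>.
  Thus \<open>\<parallel>y\<parallel>\<^sup>3 - \<parallel>y\<parallel>\<close> is of order \<open>t\<^sup>2\<close>.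
\<close>
lemma norm_add_Peirce_1_le:
  assumes K: "K \<ge> 0" "\<And>a b c. norm (triple a b c) \<le> K * norm a * norm b * norm c"
    and e: "triple e e e = e" "e \<noteq> 0" and x: "triple e e x = (1/2) *c x" "norm x \<le> 1"
    and t: "0 \<le> t" "t \<le> 1"
  shows "norm (e + t *\<^sub>R x) \<le> 1 + 2 * K * t\<^sup>2"
proof -
  define y where "y = e + t *\<^sub>R x"
  define R where "R = triple x x e + triple x x e + triple x e x + t *\<^sub>R triple x x x"
  have half: "triple e e x + triple e e x = x"
    using scaleC_add_left [of "1/2" "1/2" x] by (simp add: x)
  have "cube y = e + t *\<^sub>R (triple e e x + triple e e x) + t *\<^sub>R Q e x + t\<^sup>2 *\<^sub>R R"
    by (simp add: cube_def y_def R_def triple_expand triple_scaleR e algebra_simps power2_eq_square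
        triple_commute [of x e e] triple_commute [of e x x])
  also have "\<dots> = y + t\<^sup>2 *\<^sub>R R"
    using Peirce_1_Q [OF e(1) x(1)] by (simp only: half) (simp add: y_def)
  finally have "norm y ^ 3 \<le> norm y + t\<^sup>2 * norm R"
    using norm_triangle_ineq [of y "t\<^sup>2 *\<^sub>R R"] norm_cube [of y] by (simp add: cube_def)
  moreover have "norm R \<le> 4 * K"
  proof -
    have 1: "norm (triple a b c) \<le> K" if "norm a \<le> 1" "norm b \<le> 1" "norm c \<le> 1" for a b c
    proof -
      have "norm a * norm b * norm c \<le> 1" using that by (simp add: mult_le_one)
      then have "K * (norm a * norm b * norm c) \<le> K * 1" using K(1) by (rule mult_left_mono)
      then show ?thesis using K(2) [of a b c] by (simp add: mult.assoc)
    qed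
    have "norm e \<le> 1" using tripotent_norm [OF e] by simp
    then have *: "norm (triple x x e) \<le> K" "norm (triple x e x) \<le> K" "norm (triple x x x) \<le> K"
      using 1 x(2) by auto
    moreover have "norm (t *\<^sub>R triple x x x) \<le> K"
      using * t mult_left_le_one_le [of "norm (triple x x x)" t] by simp
    ultimately show ?thesis unfolding R_def
      by (smt (verit) norm_triangle_ineq)
  qed
  ultimately have le: "norm y ^ 3 \<le> norm y + t\<^sup>2 * (4 * K)"
    by (smt (verit) mult_left_mono zero_le_power2)
  show ?thesis
  proof (cases "norm y \<le> 1")
    case True
    then show ?thesis using K(1) by (simp add: y_def add_increasing2)
  next
    case False
    then have "1 * 2 \<le> norm y * (norm y + 1)" by (intro mult_mono) auto
    then have "2 * (norm y - 1) \<le> norm y * (norm y + 1) * (norm y - 1)"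
      using False by (intro mult_right_mono) auto
    also have "\<dots> = norm y ^ 3 - norm y" by (simp add: power3_eq_cube algebra_simps)
    finally show ?thesis using le by (simp add: y_def algebra_simps)
  qed
qed

definition rank_one :: "'a \<Rightarrow> bool" where
  "rank_one z \<longleftrightarrow> z \<noteq> 0 \<and> (\<forall>y. \<exists>c. Q z y = c *c z)"

text \<open>
  An eigenvalue belongs to the spectrum.
\<close>
lemma eigenvalue_nonneg:
  assumes "triple a a y = t *c y" "y \<noteq> 0"
  shows "Im t = 0 \<and> Re t \<ge> 0"
proof -
  have "t \<in> op_spectrum (triple a a)"
  proof (rule ccontr)
    assume "t \<notin> op_spectrum (triple a a)"
    then obtain g where g: "bounded_clinear g" "\<And>x. g (t *c x - triple a a x) = x"
      by (auto simp: op_spectrum_def)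
    have "linear g" using g(1) by (simp add: bounded_clinear_def bounded_linear.linear)
    then show False using g(2) [of y] assms by (simp add: linear_0)
  qed
  then show ?thesis using spectrum_nonneg [of a] by auto
qed

text \<open>
  \<open>Q w\<close> maps into the Peirce space \<open>E\<^sub>2(w)\<close>, and its square is the identity there.
\<close>
lemma min_tripotent_iff:
  "w \<in> min_tripotents triple \<longleftrightarrow> triple w w w = w \<and> rank_one w"
proof -
  have "peirce_space triple 2 w = range (\<lambda>c. c *c w) \<longleftrightarrow> (\<forall>y. \<exists>c. Q w y = c *c w)"
    if w: "triple w w w = w"
  proof
    assume eq: "peirce_space triple 2 w = range (\<lambda>c. c *c w)"
    have "Q w y \<in> peirce_space triple 2 w" for y
      by (simp add: peirce_space_def Peirce_L_Q [OF w])
    then show "\<forall>y. \<exists>c. Q w y = c *c w" unfolding eq by blast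
  next
    assume *: "\<forall>y. \<exists>c. Q w y = c *c w"
    have "x \<in> range (\<lambda>c. c *c w)" if "x \<in> peirce_space triple 2 w" for x
    proof -
      have "Q w (Q w x) = x" using that Peirce_Q_Q [OF w, of x] by (simp add: peirce_space_def)
      then show ?thesis using * by (metis rangeI)
    qed
    moreover have "c *c w \<in> peirce_space triple 2 w" for c
      by (simp add: peirce_space_def triple_expand w)
    ultimately show "peirce_space triple 2 w = range (\<lambda>c. c *c w)" by blast
  qed
  then show ?thesis by (auto simp: min_tripotents_def tripotent_def rank_one_def)
qed

text \<open>
  \<open>Q z z = t z\<close> with \<open>t \<ge> 0\<close> as an eigenvalue of \<open>{z, z, _}\<close>, and \<open>t = \<parallel>z\<parallel>\<^sup>2\<close> by the norm axiom.
\<close>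
lemma rank_one_normalize:
  assumes "rank_one z"
  shows "inverse (norm z) *\<^sub>R z \<in> min_tripotents triple"
proof -
  obtain t where t: "Q z z = t *c z" using assms unfolding rank_one_def by blast
  have z: "z \<noteq> 0" using assms by (simp add: rank_one_def)
  then have nn: "Im t = 0" "Re t \<ge> 0" using eigenvalue_nonneg t by blast+
  have "norm z ^ 3 = cmod t * norm z" using norm_cube [of z] by (simp add: t norm_scaleC)
  then have "cmod t = norm z ^ 2" using z by (simp add: power3_eq_cube power2_eq_square)
  then have "Q z z = (norm z)\<^sup>2 *\<^sub>R z"
    using nn by (simp add: t scaleR_eq_scaleC cmod_eq_Re complex_eq_iff)
  moreover have "\<exists>c. Q (inverse (norm z) *\<^sub>R z) y = c *c (inverse (norm z) *\<^sub>R z)" for y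
  proof -
    obtain c where "Q z y = c *c z" using assms unfolding rank_one_def by blast
    then have "Q (inverse (norm z) *\<^sub>R z) y = (c * inverse (norm z)) *c (inverse (norm z) *\<^sub>R z)"
      by (simp add: triple_expand scaleR_eq_scaleC scaleC_scaleC mult.commute)
    then show ?thesis by blast
  qed
  ultimately show ?thesis
    using z by (simp add: min_tripotent_iff rank_one_def triple_scaleR power2_eq_square field_simps)
qed

text \<open>
  The coefficient of the Peirce projection to \<open>E\<^sub>2(w)\<close>, see \<open>Q_Q_min\<close>.  The conjugation makes it linear in \<open>x\<close>,
  since \<open>Q w\<close> is conjugate-linear.
\<close>
definition coef :: "'a \<Rightarrow> 'a \<Rightarrow> complex" where
  "coef w x = (SOME c. Q w x = cnj c *c w)"

lemma Q_min:
  assumes "w \<in> min_tripotents triple"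
  shows "Q w x = cnj (coef w x) *c w"
proof -
  obtain c where "Q w x = c *c w" using assms by (auto simp: min_tripotent_iff rank_one_def)
  then have "Q w x = cnj (cnj c) *c w" by simp
  then show ?thesis unfolding coef_def by (rule someI)
qed

lemma coef_eqI:
  assumes "w \<in> min_tripotents triple" "Q w x = c *c w"
  shows "coef w x = cnj c"
proof -
  have "cnj (coef w x) *c w = c *c w" using assms Q_min by metis
  then have "cnj (coef w x) = c"
    using assms(1) by (auto simp: min_tripotent_iff rank_one_def)
  then show ?thesis by auto
qed

lemma coef_self: "w \<in> min_tripotents triple \<Longrightarrow> coef w w = 1"
  using coef_eqI [of w w 1] by (simp add: min_tripotent_iff)

lemma coef_add: "w \<in> min_tripotents triple \<Longrightarrow> coef w (x + y) = coef w x + coef w y"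
  using coef_eqI [of w "x + y" "cnj (coef w x) + cnj (coef w y)"] Q_min
  by (simp add: triple_expand scaleC_simps)

lemma coef_scale: "w \<in> min_tripotents triple \<Longrightarrow> coef w (c *c x) = c * coef w x"
  using coef_eqI [of w "c *c x" "cnj c * cnj (coef w x)"] Q_min
  by (simp add: triple_expand scaleC_simps)

lemma coef_diff: "w \<in> min_tripotents triple \<Longrightarrow> coef w (x - y) = coef w x - coef w y"
  using coef_eqI [of w "x - y" "cnj (coef w x) - cnj (coef w y)"] Q_min
  by (simp add: triple_expand scaleC_simps)

lemma Q_Q_min:
  assumes "w \<in> min_tripotents triple" 
  shows "Q w (Q w x) = coef w x *c w"
  using assms Q_min [OF assms, of x] by (simp add: triple_expand min_tripotent_iff)

text \<open>
  The fundamental formula for \<open>Q (Q w x)\<close>, applied to \<open>w\<close>.  For an eigenvector \<open>w\<close> of \<open>Q x\<close> it computes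
  \<open>coef w x\<close> from the eigenvalue.
\<close>
lemma coef_Q_self:
  assumes w: "w \<in> min_tripotents triple"
  shows "coef w (Q x w) = (coef w x)\<^sup>2"
proof -
  have "Q w (Q x w) = Q w (Q x (Q w w))" using w by (simp add: min_tripotent_iff)
  also have "\<dots> = Q (Q w x) w" by (rule fundamental_formula [symmetric])
  also have "\<dots> = (cnj (coef w x))\<^sup>2 *c w"
    using w by (simp add: Q_min [OF w, of x] triple_expand scaleC_simps power2_eq_square min_tripotent_iff)
  finally have "Q w (Q x w) = (cnj (coef w x))\<^sup>2 *c w" .
  from coef_eqI [OF w this] show ?thesis by simp
qed

lemma rank_one_Q:
  assumes "rank_one z" "Q x z \<noteq> 0"
  shows "rank_one (Q x z)"
proof -
  have "\<exists>c. Q (Q x z) y = c *c Q x z" for y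
  proof -
    obtain c where "Q z (Q x y) = c *c z" using assms unfolding rank_one_def by blast
    then have "Q (Q x z) y = cnj c *c Q x z" by (simp add: fundamental_formula triple_expand)
    then show ?thesis by blast
  qed
  then show ?thesis using assms by (simp add: rank_one_def)
qed

end

section \<open>The support functional of a minimal tripotent\<close>

context jb_star_triple
begin

text \<open>
  The functional \<open>f\<close> is estimated on the three Peirce summands.  After rotating the argument so that \<open>f\<close> is
  non-negative there, the norm bounds for \<open>w + x\<close> and \<open>w + t x\<close> leave only \<open>1 - r\<close>, respectively
  \<open>(1 - r)/t + O(t)\<close>, for the value at \<open>x\<close>; the choice \<open>t = sqrt (1 - r)\<close> is optimal up to constants.
\<close>
lemma almost_supporting_functional:
  assumes w: "w \<in> min_tripotents triple"
  obtains C where "C \<ge> 0"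
    "\<And>f r x. \<lbrakk>\<And>x y. f (x + y) = f x + f y; \<And>c x. f (c *c x) = c * f x; \<And>x. cmod (f x) \<le> norm x;
        f w = complex_of_real r; 0 \<le> r; r \<le> 1\<rbrakk>
      \<Longrightarrow> cmod (f x - coef w x) \<le> C * sqrt (1 - r) * norm x"
proof -
  obtain K where K: "K \<ge> 0" "\<And>a b c. norm (triple a b c) \<le> K * norm a * norm b * norm c"
    by (rule triple_bounded) blast
  have www: "triple w w w = w" "w \<noteq> 0" using w by (simp_all add: min_tripotent_iff rank_one_def)
  have nw: "norm w = 1" using tripotent_norm www by blast
  have L: "norm (triple w w x) \<le> K * norm x" and QK: "norm (Q w x) \<le> K * norm x" for x
    using K(2) [of w w x] K(2) [of w x w] by (simp_all add: nw)
  have LL: "norm (triple w w (triple w w x)) \<le> K * K * norm x" for x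
    using L [of "triple w w x"] mult_left_mono [OF L [of x] K(1)] by (simp add: mult.assoc)
  \<comment> \<open>\<open>B\<close> bounds the norms of the projections to \<open>E\<^sub>0(w)\<close> and \<open>E\<^sub>1(w)\<close>.\<close>
  define B where "B = 1 + K + 4 * (K + K * K)"
  have B: "B \<ge> 0" using K(1) by (simp add: B_def)
  define C where "C = K + B + B * (1 + 2 * K)"
  have "cmod (f x - coef w x) \<le> C * sqrt (1 - r) * norm x"
    if f: "\<And>x y. f (x + y) = f x + f y" "\<And>c x. f (c *c x) = c * f x" "\<And>x. cmod (f x) \<le> norm x"
      and r: "f w = complex_of_real r" "0 \<le> r" "r \<le> 1" for f r x
  proof -
    let ?s = "sqrt (1 - r)"
    have s: "0 \<le> ?s" "?s \<le> 1" "1 - r \<le> ?s" "?s\<^sup>2 = 1 - r"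
      using r by (simp_all add: real_le_rsqrt power2_eq_square mult_left_le_one_le)
    have fR: "f (t *\<^sub>R x) = complex_of_real t * f x" for t x by (simp add: scaleR_eq_scaleC f(2))
    have unit0: "cmod (f z) \<le> ?s" if z: "triple w w z = 0" "norm z \<le> 1" for z
    proof -
      obtain c where c: "cmod c = 1" "f (c *c z) = cmod (f z)"
        using unimodular_rotation [of "f z"] f(2) by metis
      have "norm (w + c *c z) \<le> 1"
        using z c by (intro norm_add_orthogonal_le www) (simp_all add: triple_expand norm_scaleC)
      then have "cmod (f (w + c *c z)) \<le> 1" using f(3) order_trans by blast
      moreover have "f (w + c *c z) = complex_of_real (r + cmod (f z))" by (simp add: f(1) c r)
      ultimately show ?thesis using r s by (simp only: norm_of_real)
    qed
    have unit1: "cmod (f z) \<le> (1 + 2 * K) * ?s" if z: "triple w w z = (1/2) *c z" "norm z \<le> 1" for z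
    proof -
      obtain c where c: "cmod c = 1" "f (c *c z) = cmod (f z)"
        using unimodular_rotation [of "f z"] f(2) by metis
      have key: "t * cmod (f z) \<le> ?s\<^sup>2 + 2 * K * t\<^sup>2" if t: "0 \<le> t" "t \<le> 1" for t
      proof -
        have "norm (w + t *\<^sub>R (c *c z)) \<le> 1 + 2 * K * t\<^sup>2"
          using z c t by (intro norm_add_Peirce_1_le K www)
            (simp_all add: triple_expand norm_scaleC complex_vector.scale_left_commute)
        then have "cmod (f (w + t *\<^sub>R (c *c z))) \<le> 1 + 2 * K * t\<^sup>2" using f(3) order_trans by blast
        moreover have "f (w + t *\<^sub>R (c *c z)) = complex_of_real (r + t * cmod (f z))"
          by (simp add: f(1) fR c r)
        ultimately have "\<bar>r + t * cmod (f z)\<bar> \<le> 1 + 2 * K * t\<^sup>2" by (simp only: norm_of_real)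
        then show ?thesis using s(4) by linarith
      qed
      show ?thesis
      proof (cases "?s = 0")
        case False
        have "?s * cmod (f z) \<le> ?s * ((1 + 2 * K) * ?s)"
          using key [OF s(1,2)] by (simp add: power2_eq_square algebra_simps)
        then show ?thesis using False s(1) by (simp add: mult_le_cancel_left)
      next
        \<comment> \<open>For \<open>r = 1\<close> let \<open>t\<close> tend to \<open>0\<close>.\<close>
        case True
        have "cmod (f z) \<le> 0 + d" if "d > 0" for d
        proof -
          define t where "t = min 1 (d / (2 * K + 1))"
          have t: "0 < t" "t \<le> 1" using that K(1) by (simp_all add: t_def)
          have "t * cmod (f z) \<le> t * (2 * K * t)"
            using key [of t] t True by (simp add: power2_eq_square algebra_simps)
          then have "cmod (f z) \<le> (2 * K + 1) * t" using t by (simp add: algebra_simps)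
          also have "\<dots> \<le> (2 * K + 1) * (d / (2 * K + 1))"
            using K(1) by (intro mult_left_mono) (simp_all add: t_def)
          finally show ?thesis using K(1) by simp
        qed
        then have "cmod (f z) \<le> 0" by (rule field_le_epsilon)
        then show ?thesis using True by simp
      qed
    qed
    have scale: "cmod (f z) \<le> M * norm z"
      if "\<And>y. norm y \<le> 1 \<Longrightarrow> triple w w y = c *c y \<Longrightarrow> cmod (f y) \<le> M" "triple w w z = c *c z" for c M z
    proof (cases "z = 0")
      case False
      have "cmod (f (inverse (norm z) *\<^sub>R z)) \<le> M"
        using False that(2) by (intro that(1))
          (simp_all add: triple_scaleR scaleR_eq_scaleC triple_expand scaleC_simps norm_scaleC mult.commute norm_inverse)
      then show ?thesis using False by (simp add: fR norm_mult norm_divide norm_inverse field_simps)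
    qed (use f(3) [of 0] in simp)
    obtain x1 x0 where x: "x = Q w (Q w x) + x1 + x0" "triple w w x1 = (1/2) *c x1" "triple w w x0 = 0"
      "x1 = 4 *c (triple w w x - triple w w (triple w w x))"
      using Peirce_decomposition [OF www(1)] by metis
    have QQ: "Q w (Q w x) = coef w x *c w" by (rule Q_Q_min [OF w])
    have coefK: "cmod (coef w x) \<le> K * norm x"
      using QK [of x] by (simp add: Q_min [OF w] norm_scaleC nw)
    have "norm x1 = 4 * norm (triple w w x - triple w w (triple w w x))"
      unfolding x(4) by (simp only: norm_scaleC) simp
    then have n1: "norm x1 \<le> 4 * (K + K * K) * norm x"
      using norm_triangle_ineq4 [of "triple w w x" "triple w w (triple w w x)"] L [of x] LL [of x]
      by (simp add: distrib_right)
    have "x0 = x - coef w x *c w - x1" using x(1) QQ by (simp add: algebra_simps)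
    then have "norm x0 \<le> norm x + norm (coef w x *c w) + norm x1"
      by (smt (verit) norm_triangle_ineq4)
    then have n0: "norm x0 \<le> B * norm x"
      using coefK n1 by (simp add: B_def norm_scaleC nw algebra_simps)
    have n1: "norm x1 \<le> B * norm x"
      by (rule order_trans [OF n1]) (use K(1) in \<open>auto simp: B_def intro: mult_right_mono\<close>)
    have f0: "cmod (f x0) \<le> ?s * (B * norm x)"
      using scale [of 0 ?s x0] unit0 x(3) mult_left_mono [OF n0 s(1)] by simp
    have f1: "cmod (f x1) \<le> (1 + 2 * K) * ?s * (B * norm x)"
    proof -
      have "cmod (f x1) \<le> (1 + 2 * K) * ?s * norm x1" using scale unit1 x(2) by blast
      also have "\<dots> \<le> (1 + 2 * K) * ?s * (B * norm x)" using n1 s(1) K(1) by (intro mult_left_mono) auto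
      finally show ?thesis .
    qed
    have "f x = coef w x * complex_of_real r + f x1 + f x0"
      by (subst x(1)) (simp add: QQ f r)
    then have "f x - coef w x = f x1 + f x0 - complex_of_real (1 - r) * coef w x"
      by (simp add: algebra_simps)
    then have "cmod (f x - coef w x) \<le> cmod (f x1) + cmod (f x0) + (1 - r) * cmod (coef w x)"
      using norm_triangle_ineq4 [of "f x1 + f x0" "complex_of_real (1 - r) * coef w x"]
        norm_triangle_ineq [of "f x1" "f x0"] r(3)
      by (simp add: norm_mult del: of_real_diff)
    moreover have "(1 - r) * cmod (coef w x) \<le> ?s * (K * norm x)"
      using s r coefK by (intro mult_mono) auto
    ultimately show ?thesis using f0 f1 by (simp add: C_def algebra_simps)
  qed
  moreover have "C \<ge> 0" using K(1) B by (simp add: C_def)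
  ultimately show thesis using that by blast
qed

end

context jbw_star_triple
begin

lemma J_add: "J (x + y) = J x + J y" and J_scale: "J (c *c x) p = c * J x p"
  and norm_J: "norm (J x) = norm x"
  and range_J: "range J = {f. bounded_clinear (blinfun_apply f)}"
  using predual unfolding is_predual_def by auto

lemma J_scale_arg: "J x (c *c p) = c * J x p"
  using range_J unfolding bounded_clinear_def scaleC_complex_def by blast

lemma J_le: "cmod (J x p) \<le> norm x * norm p"
  using norm_blinfun [of "J x" p] by (simp add: norm_J)

lemma J_le_unit: "norm p \<le> 1 \<Longrightarrow> cmod (J x p) \<le> norm x"
  using J_le [of x p] mult_left_le [of "norm p" "norm x"] by simp

text \<open>
  A norming functional on the predual is represented by an element of the triple.
\<close>
lemma predual_norming:
  obtains x where "norm x \<le> 1" "J x p = norm p"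
proof -
  obtain f :: "'p \<Rightarrow>\<^sub>L complex" where f: "bounded_clinear (blinfun_apply f)" "\<And>q. cmod (f q) \<le> norm q" "f p = norm p"
    using norming_functional by blast
  then obtain x where "J x = f" using range_J by (metis (mono_tags, lifting) image_iff mem_Collect_eq)
  moreover have "norm f \<le> 1" by (rule norm_blinfun_bound) (simp_all add: f)
  ultimately show thesis using that f norm_J by metis
qed

lemma predual_eqI:
  assumes "\<And>x. J x p = J x q"
  shows "p = q"
  using predual_norming [of "p - q"] assms
  by (metis blinfun.diff_right eq_iff_diff_eq_0 norm_eq_zero of_real_eq_0_iff)

text \<open>
  A maximizing sequence for \<open>J w\<close> on the unit ball of the predual is a Cauchy sequence, because
  each member is close in norm to \<open>coef w\<close>.
\<close>
lemma predual_coef: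
  assumes w: "w \<in> min_tripotents triple"
  obtains p where "norm p \<le> 1" "J w p = 1" "\<And>x. J x p = coef w x"
    "\<And>q. norm q \<le> 1 \<Longrightarrow> J w q = 1 \<Longrightarrow> q = p"
proof -
  have www: "triple w w w = w" "w \<noteq> 0" using w by (simp_all add: min_tripotent_iff rank_one_def)
  have nw: "norm w = 1" using tripotent_norm www by blast
  obtain C where C: "C \<ge> 0" and asf: "\<And>f r x. \<lbrakk>\<And>x y. f (x + y) = f x + f y; \<And>c x. f (c *c x) = c * f x; \<And>x. cmod (f x) \<le> norm x;
        f w = complex_of_real r; 0 \<le> r; r \<le> 1\<rbrakk>
      \<Longrightarrow> cmod (f x - coef w x) \<le> C * sqrt (1 - r) * norm x"
    by (rule almost_supporting_functional [OF w]) blast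
  have near: "cmod (J x p - coef w x) \<le> C * sqrt (1 - r) * norm x"
    if "norm p \<le> 1" "J w p = complex_of_real r" "0 \<le> r" "r \<le> 1" for p r x
    using that by (intro asf) (simp_all add: J_add J_scale blinfun.add_left J_le_unit)
  have approx: "\<exists>p. norm p \<le> 1 \<and> (\<exists>r. J w p = complex_of_real r \<and> 1 - d \<le> r \<and> 0 \<le> r \<and> r \<le> 1)" if d: "0 < d" "d < 1" for d
  proof -
    have "\<exists>q. \<not> cmod (J w q) \<le> (1 - d) * norm q"
    proof (rule ccontr)
      assume "\<nexists>q. \<not> cmod (J w q) \<le> (1 - d) * norm q"
      then have "norm (J w) \<le> 1 - d" using d by (intro norm_blinfun_bound) auto
      then show False using norm_J [of w] nw d by simp
    qed
    then obtain q where q: "cmod (J w q) > (1 - d) * norm q" unfolding not_le by blast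
    then have "q \<noteq> 0" by auto
    obtain u where u: "cmod u = 1" "u * J w q = cmod (J w q)" by (rule unimodular_rotation)
    define c where "c = u / norm q"
    have 1: "norm (c *c q) = 1" using \<open>q \<noteq> 0\<close> u by (simp add: c_def norm_scaleC norm_divide)
    have "J w (c *c q) = cmod (J w q) / norm q"
      using u(2) by (simp add: J_scale_arg c_def)
    moreover have "cmod (J w q) / norm q \<ge> 1 - d" using q \<open>q \<noteq> 0\<close> by (simp add: field_simps)
    moreover have "cmod (J w q) / norm q \<le> 1" using J_le [of w q] \<open>q \<noteq> 0\<close> by (simp add: nw)
    ultimately show ?thesis using 1 by (intro exI [of _ "c *c q"]) (auto simp flip: of_real_divide)
  qed
  have "\<forall>n. \<exists>p. norm p \<le> 1 \<and> (\<exists>r. J w p = complex_of_real r \<and> 1 - inverse (real (n + 2)) \<le> r \<and> 0 \<le> r \<and> r \<le> 1)"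
    by (intro allI approx) (simp_all add: inverse_less_1_iff)
  then obtain p r where p: "\<And>n. norm (p n) \<le> 1" "\<And>n. J w (p n) = complex_of_real (r n)"
    and r: "\<And>n. 1 - inverse (real (n + 2)) \<le> r n" "\<And>n. 0 \<le> r n" "\<And>n. r n \<le> 1" by metis
  define \<delta> where "\<delta> n = C * sqrt (inverse (real (n + 2)))" for n
  have near_n: "cmod (J x (p n) - coef w x) \<le> \<delta> n" if "norm x \<le> 1" for x n
  proof -
    have "cmod (J x (p n) - coef w x) \<le> C * sqrt (1 - r n) * norm x" using near p r by blast
    also have "\<dots> \<le> C * sqrt (1 - r n)" using that C r by (simp add: mult_left_le)
    also have "\<dots> \<le> \<delta> n" unfolding \<delta>_def using C r(1) [of n] by (intro mult_left_mono) auto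
    finally show ?thesis .
  qed
  have \<delta>0: "\<delta> \<longlonglongrightarrow> 0"
  proof -
    have "(\<lambda>n. inverse (real (n + 2))) \<longlonglongrightarrow> 0"
      by (rule LIMSEQ_ignore_initial_segment [OF lim_inverse_n])
    then have "(\<lambda>n. C * sqrt (inverse (real (n + 2)))) \<longlonglongrightarrow> C * sqrt 0"
      by (intro tendsto_intros)
    then show ?thesis by (simp add: \<delta>_def [abs_def])
  qed
  have dist: "norm (p i - p j) \<le> \<delta> i + \<delta> j" for i j
  proof -
    obtain x where x: "norm x \<le> 1" "J x (p i - p j) = norm (p i - p j)" using predual_norming .
    have "norm (p i - p j) = cmod ((J x (p i) - coef w x) - (J x (p j) - coef w x))"
      using x(2) by (simp add: blinfun.diff_right)
    also have "\<dots> \<le> \<delta> i + \<delta> j"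
      using norm_triangle_ineq4 near_n [OF x(1)] by (smt (verit))
    finally show ?thesis .
  qed
  have "Cauchy p"
  proof (rule CauchyI)
    fix e :: real assume "e > 0"
    then have "\<forall>\<^sub>F n in sequentially. dist (\<delta> n) 0 < e / 2" using \<delta>0 by (intro tendstoD) auto
    then obtain M where "\<forall>n\<ge>M. \<bar>\<delta> n\<bar> < e / 2"
      by (auto simp: eventually_sequentially dist_real_def)
    then have M: "\<delta> n < e / 2" if "n \<ge> M" for n using that by (smt (verit))
    show "\<exists>M. \<forall>m\<ge>M. \<forall>n\<ge>M. norm (p m - p n) < e"
    proof (intro exI [of _ M] allI impI)
      fix m n assume "M \<le> m" "M \<le> n"
      then show "norm (p m - p n) < e" using dist [of m n] M [of m] M [of n] by linarith
    qed
  qed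
  then obtain P where P: "p \<longlonglongrightarrow> P" using Cauchy_convergent_iff convergentD by blast
  have nP: "norm P \<le> 1"
    using tendsto_norm [OF P] p(1) by (intro LIMSEQ_le_const2 [of "\<lambda>n. norm (p n)"]) auto
  have "(\<lambda>n. J w (p n)) \<longlonglongrightarrow> J w P" using P by (intro tendsto_intros)
  moreover have "(\<lambda>n. J w (p n)) \<longlonglongrightarrow> 1"
  proof -
    have "(\<lambda>n. J w (p n) - coef w w) \<longlonglongrightarrow> 0"
      by (rule Lim_null_comparison [OF _ \<delta>0]) (use near_n nw in auto)
    then show ?thesis by (simp add: coef_self [OF w] LIM_zero_iff)
  qed
  ultimately have JP: "J w P = 1" using LIMSEQ_unique by blast
  have J_coef: "J x q = coef w x" if "norm q \<le> 1" "J w q = 1" for q x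
    using near [of q 1 x] that by simp
  have "q = P" if "norm q \<le> 1" "J w q = 1" for q
    using J_coef nP JP that by (intro predual_eqI) simp
  then show thesis using that nP JP J_coef by blast
qed

lemma coef_le_norm:
  assumes "w \<in> min_tripotents triple"
  shows "cmod (coef w x) \<le> norm x"
proof -
  obtain p where p: "norm p \<le> 1" "\<And>x. J x p = coef w x" using predual_coef [OF assms] by metis
  then show ?thesis using J_le_unit [of p x] by simp
qed

text \<open>
  If \<open>p\<close> lies between \<open>a\<close> and \<open>b\<close> in the unit ball, then \<open>J w a = J w b = 1\<close>, since \<open>1\<close> is an extreme point of the
  unit disc; by uniqueness \<open>a = b = p\<close>.
\<close>
lemma TTP_eq_coef:
  assumes w: "w \<in> min_tripotents triple"
  shows "TTP J x w = coef w x"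
proof -
  obtain p where p: "norm p \<le> 1" "J w p = 1" "\<And>x. J x p = coef w x"
    "\<And>q. norm q \<le> 1 \<Longrightarrow> J w q = 1 \<Longrightarrow> q = p" using predual_coef [OF w] by metis
  have "triple w w w = w" "w \<noteq> 0" using w by (simp_all add: min_tripotent_iff rank_one_def)
  then have nw: "norm w = 1" by (rule tripotent_norm)
  have "p extreme_point_of cball 0 1"
    unfolding extreme_point_of_def
  proof (intro conjI ballI notI)
    show "p \<in> cball 0 1" using p(1) by simp
    fix a b assume ab: "a \<in> cball 0 1" "b \<in> cball 0 1" and "p \<in> open_segment a b"
    then obtain u where u: "0 < u" "u < 1" "p = (1 - u) *\<^sub>R a + u *\<^sub>R b" "a \<noteq> b"
      by (auto simp: in_segment)
    have le: "cmod (J w q) \<le> 1" if "norm q \<le> 1" for q using J_le_unit [OF that, of w] by (simp add: nw)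
    have one: "z = 1" if "cmod z \<le> 1" "Re z \<ge> 1" for z
    proof -
      have "(Re z)\<^sup>2 + (Im z)\<^sup>2 \<le> 1" using that by (simp add: cmod_def)
      moreover have "(Re z)\<^sup>2 \<ge> 1" using that by simp
      ultimately have "(Im z)\<^sup>2 \<le> 0" by linarith
      then have "Im z = 0" by simp
      moreover have "Re z \<le> 1" using that complex_Re_le_cmod [of z] by linarith
      ultimately show ?thesis using that by (simp add: complex_eq_iff)
    qed
    have re: "Re (J w a) \<le> 1" "Re (J w b) \<le> 1" "cmod (J w a) \<le> 1" "cmod (J w b) \<le> 1"
      using le [of a] le [of b] ab complex_Re_le_cmod [of "J w a"] complex_Re_le_cmod [of "J w b"] by simp_all
    have "(1 - u) * Re (J w a) + u * Re (J w b) = 1"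
      using arg_cong [OF p(2), of Re] by (simp add: u(3) blinfun.add_right blinfun.scaleR_right)
    then have "(1 - u) * (1 - Re (J w a)) + u * (1 - Re (J w b)) = 0" by (simp add: algebra_simps)
    moreover have "(1 - u) * (1 - Re (J w a)) \<ge> 0" "u * (1 - Re (J w b)) \<ge> 0" using u re by simp_all
    ultimately have "(1 - u) * (1 - Re (J w a)) = 0" "u * (1 - Re (J w b)) = 0" by linarith+
    then have "J w a = 1" "J w b = 1" using u re one by auto
    then have "a = p" "b = p" using p(4) ab mem_cball_0 by blast+
    then show False using u(4) by simp
  qed
  moreover have "q = p" if "q extreme_point_of cball 0 1" "J w q = 1" for q
    using that by (intro p(4)) (auto simp: extreme_point_of_def)
  ultimately have "support_functional J w = p"
    unfolding support_functional_def using p(2) by blast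
  then show ?thesis by (simp add: TTP_def p(3))
qed

end

section \<open>Two minimal tripotents\<close>

context jb_star_triple
begin

text \<open>
  Two evaluations of \<open>{e, v, {e, v, e}}\<close> show that a non-zero coefficient is the conjugate of the other one.
\<close>
lemma coef_commute:
  assumes e: "e \<in> min_tripotents triple" and v: "v \<in> min_tripotents triple"
  shows "coef e v = cnj (coef v e)"
proof -
  have *: "coef e v = 0 \<or> coef e v = cnj (coef v e)"
    if e: "e \<in> min_tripotents triple" and v: "v \<in> min_tripotents triple" for e v
  proof -
    let ?b = "cnj (coef e v)"
    have eee: "triple e e e = e" "e \<noteq> 0" using e by (simp_all add: min_tripotent_iff rank_one_def)
    have "?b\<^sup>2 *c e = ?b\<^sup>2 *c e + ?b\<^sup>2 *c e - (coef v e * ?b) *c e"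
      using jordan_identity [of e v e v e] triple_commute [of "Q e v" v e]
      by (simp add: Q_min [OF e, of v] Q_min [OF v, of e] triple_expand scaleC_simps eee power2_eq_square)
    then have "?b\<^sup>2 *c e = (coef v e * ?b) *c e" unfolding eq_diff_eq add_left_cancel by auto
    then have "?b * ?b = coef v e * ?b" using eee by (simp add: power2_eq_square)
    then have "?b = 0 \<or> ?b = coef v e" by simp
    then show ?thesis by (metis complex_cnj_cnj complex_cnj_zero)
  qed
  show ?thesis using * [OF e v] * [OF v e] by (metis complex_cnj_cnj complex_cnj_zero)
qed

context
  fixes e v :: 'a
  assumes e: "e \<in> min_tripotents triple" and v: "v \<in> min_tripotents triple"
begin

lemma Q_L_min: "Q e (triple e e v) = coef v e *c e"
  using Peirce_Q_L [of e v] e Q_min [OF e, of v] coef_commute [OF e v] by (simp add: min_tripotent_iff)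

text \<open>
  The Jordan identity for \<open>{e, e, {v, v, v}}\<close> shows that \<open>{e, e, v}\<close> has no component in \<open>E\<^sub>0(v)\<close> and
  that its component in \<open>E\<^sub>2(v)\<close> is fixed by \<open>Q v\<close>.
\<close>
lemma L_min_Peirce:
  shows "Q v (triple e e v) = coef v (triple e e v) *c v"
    and "triple v v (triple e e v) + triple v v (triple e e v) =
      triple e e v + coef v (triple e e v) *c v"
    and "cnj (coef v (triple e e v)) = coef v (triple e e v)"
proof -
  let ?a = "triple e e v" let ?m = "coef v ?a"
  have vvv: "triple v v v = v" "v \<noteq> 0" using v by (simp_all add: min_tripotent_iff rank_one_def)
  have 1: "triple v v ?a + triple v v ?a = ?a + Q v ?a"
    using jordan_identity [of e e v v v] triple_commute [of ?a v v] by (simp add: vvv algebra_simps)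
  have "Q v (triple v v ?a + triple v v ?a) = Q v ?a + Q v (Q v ?a)"
    by (simp add: 1 triple_expand)
  then have 2: "Q v ?a = ?m *c v"
    by (simp add: triple_expand Peirce_Q_L vvv Q_Q_min [OF v])
  then show "Q v ?a = ?m *c v" .
  show "cnj ?m = ?m" using coef_eqI [OF v 2] by simp
  show "triple v v ?a + triple v v ?a = ?a + ?m *c v" using 1 2 by simp
qed

end

context
  fixes e v a b :: 'a and \<alpha> m :: complex
  assumes e: "e \<in> min_tripotents triple" and v: "v \<in> min_tripotents triple"
  defines "a \<equiv> triple e e v" and "b \<equiv> triple v v e"
    and "\<alpha> \<equiv> coef v e" and "m \<equiv> coef e b"
begin

text \<open>
  Two applications of the Jordan identity give the sum and the difference of \<open>{a, v, e}\<close> and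
  \<open>{v, a, e}\<close>.
\<close>
lemma pair_mixed:
  shows "triple a v e + triple a v e = \<alpha> *c a + m *c e"
    and "triple v a e + triple v a e = \<alpha> *c a + b"
proof -
  have eee: "triple e e e = e" using e by (simp add: min_tripotent_iff)
  have Qev: "Q e v = \<alpha> *c e"
    using Q_min [OF e, of v] coef_commute [OF e v] by (simp add: \<alpha>_def)
  have Lb: "triple e e b + triple e e b = b + m *c e"
    using L_min_Peirce(2) [OF v e] by (simp add: b_def m_def)
  have 1: "triple e e b = b + triple a v e - triple v a e"
    using jordan_identity [of e e v v e] by (simp add: eee a_def b_def)
  have 2: "triple a v e = triple e e b + \<alpha> *c a - triple v a e"
    using jordan_identity [of e v e e v] triple_commute [of e v v] triple_commute [of e v a]
      triple_commute [of v e e] triple_commute [of e a v]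
    by (simp add: a_def b_def Qev triple_expand)
  have 3: "triple v a e = b + triple a v e - triple e e b" using 1 by simp
  have "triple a v e = triple e e b + \<alpha> *c a - (b + triple a v e - triple e e b)"
    using 2 unfolding 3 .
  then have "triple a v e + triple a v e = (triple e e b + triple e e b) - b + \<alpha> *c a"
    by (simp add: algebra_simps)
  then show A: "triple a v e + triple a v e = \<alpha> *c a + m *c e"
    by (simp add: Lb algebra_simps)
  have "triple v a e + triple v a e =
      (triple a v e + triple a v e) + (b + b) - (triple e e b + triple e e b)"
    unfolding 3 by simp
  then show "triple v a e + triple v a e = \<alpha> *c a + b" by (simp add: A Lb algebra_simps)
qed

end

text \<open>
  The conclusions, halved, are \<open>2 {a, a, a} = m a\<close> and \<open>2 {a, a, a} = m' a\<close>.  The cube is evaluated twice,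
  with its last factor written as \<open>{e, e, v}\<close> and with its first factor written as \<open>{v, e, e}\<close>.
\<close>
lemma L_cube_orthogonal_coef:
  assumes e: "e \<in> min_tripotents triple" and v: "v \<in> min_tripotents triple"
    and zero: "coef v e = 0"
  defines "a \<equiv> triple e e v" and "m \<equiv> coef v (triple e e v)" and "m' \<equiv> coef e (triple v v e)"
  shows "(triple a a a + triple a a a) + (triple a a a + triple a a a) = m *c a + m *c a"
    and "(triple a a a + triple a a a) + (triple a a a + triple a a a) = m' *c a + m' *c a"
proof -
  have eee: "triple e e e = e" using e by (simp add: min_tripotent_iff)
  have Qev: "Q e v = 0" and Qve: "Q v e = 0"
    using Q_min [OF e, of v] coef_commute [OF e v] Q_min [OF v, of e] by (simp_all add: zero)
  have Qva: "Q v a = m *c v" and m': "cnj m' = m'"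
    using L_min_Peirce [OF e v] L_min_Peirce [OF v e] by (simp_all add: a_def m_def m'_def)
  have Qea: "Q e a = 0" using Q_L_min [OF e v] by (simp add: a_def zero)
  have X2: "triple a v e + triple a v e = m' *c e"
    using pair_mixed [OF e v] by (simp add: a_def m'_def zero)
  have Le_a: "triple e e a + triple e e a = a"
    using Peirce_Q_Q [OF eee, of v] Qev by (simp add: a_def)
  have aae: "triple a a e + triple a a e = Q e (triple a v e)"
    using jordan_identity [of v e e a e] triple_commute [of v e e] triple_commute [of e a a] triple_commute [of e v a]
    by (simp add: Qea a_def [symmetric] algebra_simps)
  have "Q e (triple a v e + triple a v e) = m' *c e"
    unfolding X2 by (simp add: triple_expand eee m')
  then have aae4: "(triple a a e + triple a a e) + (triple a a e + triple a a e) = m' *c e"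
    unfolding aae by (simp add: triple_add_middle)
  have aav: "triple a a v + triple a a v = m *c a + Q v (triple e e a)"
    using jordan_identity [of e e v a v] triple_commute [of v a a]
    by (simp add: Qva triple_expand a_def [symmetric] algebra_simps)
  have "Q v (triple e e a + triple e e a) = m *c v" by (simp add: Le_a Qva)
  then have aav4: "(triple a a v + triple a a v) + (triple a a v + triple a a v) = (m *c a + m *c a) + m *c v"
    unfolding aav by (simp add: triple_expand algebra_simps)
  have "triple v e a + triple a e v = 0"
    using jordan_identity [of e e v e v] unfolding Qve eee a_def [symmetric] by simp
  then have vea: "triple v e a = 0"
    unfolding triple_commute [of a e v] by (rule double_eq_zero)
  let ?c = "triple a a a"
  have 1: "?c = triple e e (triple a a v) + triple (triple a a e) e v - triple e (triple a a e) v"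
    using jordan_identity [of a a e e v] by (simp add: a_def [symmetric])
  have "(?c + ?c) + (?c + ?c) =
      triple e e ((triple a a v + triple a a v) + (triple a a v + triple a a v))
      + triple ((triple a a e + triple a a e) + (triple a a e + triple a a e)) e v
      - triple e ((triple a a e + triple a a e) + (triple a a e + triple a a e)) v"
    unfolding 1 by (simp only: triple_expand) (simp add: algebra_simps)
  also have "\<dots> = m *c (triple e e a + triple e e a) + m *c a"
    unfolding aae4 aav4 by (simp add: triple_expand m' a_def [symmetric] scaleC_simps)
  finally show "(?c + ?c) + (?c + ?c) = m *c a + m *c a" by (simp add: Le_a)
  have 2: "?c = triple v e (triple a a e) + triple e (triple a v e) a"
    using jordan_identity [of v e e a a] triple_commute [of e a a] triple_commute [of v e e] vea
      triple_commute [of e v a]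
    by (simp add: a_def [symmetric])
  have "(?c + ?c) + (?c + ?c) =
      triple v e ((triple a a e + triple a a e) + (triple a a e + triple a a e))
      + (triple e (triple a v e + triple a v e) a + triple e (triple a v e + triple a v e) a)"
    unfolding 2 by (simp only: triple_expand) (simp add: algebra_simps)
  also have "\<dots> = m' *c a + m' *c (triple e e a + triple e e a)"
    unfolding aae4 X2 using triple_commute [of v e e]
    by (simp add: triple_expand m' a_def [symmetric] scaleC_simps)
  finally show "(?c + ?c) + (?c + ?c) = m' *c a + m' *c a" by (simp add: Le_a)
qed

text \<open>
  If \<open>coef v e\<close> is not zero, the two numbers are compared by applying \<open>Q v\<close> to \<open>{a, v, e}\<close>, where
  \<open>a = {e, e, v}\<close>.  Otherwise they are compared through the cube of \<open>a\<close>.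
\<close>
lemma coef_L_commute:
  assumes e: "e \<in> min_tripotents triple" and v: "v \<in> min_tripotents triple"
  shows "coef e (triple v v e) = coef v (triple e e v)"
proof -
  define a b where "a = triple e e v" and "b = triple v v e"
  define \<alpha> m m' where "\<alpha> = coef v e" and "m = coef v a" and "m' = coef e b"
  have eee: "triple e e e = e" "e \<noteq> 0" and vvv: "triple v v v = v" "v \<noteq> 0"
    using e v by (simp_all add: min_tripotent_iff rank_one_def)
  have Qev: "Q e v = \<alpha> *c e" and Qve: "Q v e = cnj \<alpha> *c v"
    using Q_min [OF e, of v] coef_commute [OF e v] Q_min [OF v, of e] by (simp_all add: \<alpha>_def)
  have Qva: "Q v a = m *c v"
    using L_min_Peirce [OF e v] by (simp_all add: a_def m_def)
  have Qeb: "Q e b = m' *c e" and m': "cnj m' = m'"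
    using L_min_Peirce [OF v e] by (simp_all add: b_def m'_def)
  have XX: "triple a v e + triple a v e = \<alpha> *c a + m' *c e"
    using pair_mixed [OF e v] by (simp add: a_def b_def \<alpha>_def m'_def)
  have "m' = m"
  proof (cases "\<alpha> = 0")
    case False
    \<comment> \<open>\<open>{a, v, e}\<close> is the middle entry in the last term of the Jordan identity for \<open>{v, a, {v, e, v}}\<close>.\<close>
    have "Q v (triple a v e) = (m * cnj \<alpha>) *c v"
      using jordan_identity [of v a v e v] triple_commute [of "Q v a" e v] triple_commute [of e v a]
      by (simp add: Qva Qve triple_expand scaleC_simps mult.commute)
    then have "Q v (triple a v e + triple a v e) = (2 * m * cnj \<alpha>) *c v"
      by (simp add: triple_expand mult.assoc flip: scaleC_add_left)
    then have "(2 * m * cnj \<alpha>) *c v = (cnj \<alpha> * m + m' * cnj \<alpha>) *c v"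
      unfolding XX by (simp add: triple_expand Qva Qve scaleC_simps m')
    then have "2 * m * cnj \<alpha> = cnj \<alpha> * m + m' * cnj \<alpha>" using vvv by simp
    then have "cnj \<alpha> * (m - m') = 0" by (simp add: algebra_simps)
    then show ?thesis using False by simp
  next
    case orth: True
    show ?thesis
    proof (cases "a = 0")
      \<comment> \<open>Here \<open>e\<close> and \<open>v\<close> are orthogonal.\<close>
      case True
      then have "b = 0"
        using Peirce_0_orthogonal(1) [OF eee(1), of v v] triple_commute [of v v e] by (simp add: a_def b_def)
      then show ?thesis
        using True Qva Qeb eee vvv by simp
    next
      case False
      have "m' *c a + m' *c a = m *c a + m *c a"
        using L_cube_orthogonal_coef [OF e v] orth by (simp add: a_def m_def m'_def \<alpha>_def b_def)
      then have "m' *c a = m *c a" by (rule double_cancel)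
      then show ?thesis using False by simp
    qed
  qed
  then show ?thesis by (simp add: m_def m'_def a_def b_def)
qed

end

section \<open>The difference of two minimal tripotents\<close>

context jb_star_triple
begin

text \<open>
  By the fundamental formula the cube of \<open>(Q x)\<^sup>k x\<close> is \<open>(Q x)\<close> to the power \<open>3 k + 1\<close>, applied to \<open>x\<close>.
\<close>
lemma cube_iterate_Q_power: "\<exists>k. 2 * k + 1 = 3 ^ n \<and> (cube ^^ n) x = ((Q x) ^^ k) x"
proof (induction n)
  case (Suc n)
  then obtain k where k: "2 * k + 1 = 3 ^ n" "(cube ^^ n) x = ((Q x) ^^ k) x" by blast
  have "(cube ^^ Suc n) x = ((Q x) ^^ (2 * k + 1)) (((Q x) ^^ k) x)"
    using Q_power_fundamental [where x = x and k = k and z = "((Q x) ^^ k) x"] by (simp add: k(2) cube_def)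
  also have "\<dots> = ((Q x) ^^ ((2 * k + 1) + k)) x"
    by (simp only: funpow_add comp_apply)
  finally show ?case using k(1) by (intro exI [of _ "3 * k + 1"]) (simp add: algebra_simps)
qed (auto intro: exI [of _ 0])

text \<open>
  Coordinates for the \<open>Q (e - v)\<close>-invariant span of the four vectors, which need not be linearly
  independent.
\<close>
definition comb :: "'a \<Rightarrow> 'a \<Rightarrow> complex \<Rightarrow> complex \<Rightarrow> complex \<Rightarrow> complex \<Rightarrow> 'a" where
  "comb e v p q r s = p *c e + q *c v + r *c triple e e v + s *c triple v v e"

lemma comb_add: "comb e v p q r s + comb e v p' q' r' s' = comb e v (p + p') (q + q') (r + r') (s + s')"
  by (simp add: comb_def scaleC_add_left algebra_simps)

lemma comb_scale: "c *c comb e v p q r s = comb e v (c * p) (c * q) (c * r) (c * s)"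
  by (simp add: comb_def scaleC_simps)

lemma comb_diff: "comb e v p q r s - comb e v p' q' r' s' = comb e v (p - p') (q - q') (r - r') (s - s')"
  by (simp add: comb_def complex_vector.scale_left_diff_distrib algebra_simps)

lemma Q_diff: "Q (e - v) y = Q e y - (triple v y e + triple v y e) + Q v y"
  using triple_commute [of e y v] by (simp add: triple_expand algebra_simps)

lemma Q_diff_comb:
  assumes e: "e \<in> min_tripotents triple" and v: "v \<in> min_tripotents triple"
    and \<alpha>: "coef v e = \<alpha>" and m: "coef v (triple e e v) = m"
  shows "Q (e - v) (comb e v p q r s) =
    comb e v (cnj p + cnj q * \<alpha> + cnj r * \<alpha> + cnj s * m)
      (cnj p * cnj \<alpha> + cnj q + cnj r * m + cnj s * cnj \<alpha>)
      (- 2 * cnj p - cnj r * \<alpha> - cnj s)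
      (- 2 * cnj q - cnj r - cnj s * cnj \<alpha>)"
proof -
  define a b where "a = triple e e v" and "b = triple v v e"
  have eee: "triple e e e = e" "triple v v v = v" using e v by (simp_all add: min_tripotent_iff)
  have \<alpha>': "coef e v = cnj \<alpha>" using coef_commute [OF e v] \<alpha> by simp
  have m': "coef e b = m" using coef_L_commute [OF e v] m by (simp add: b_def)
  have Qev: "Q e v = \<alpha> *c e" and Qve: "Q v e = cnj \<alpha> *c v"
    using Q_min [OF e, of v] Q_min [OF v, of e] by (simp_all add: \<alpha> \<alpha>')
  have Qa: "Q e a = \<alpha> *c e" "Q v a = m *c v"
    using Q_L_min [OF e v] L_min_Peirce(1) [OF e v] by (simp_all add: a_def \<alpha> m)
  have Qb: "Q v b = cnj \<alpha> *c v" "Q e b = m *c e"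
    using Q_L_min [OF v e] L_min_Peirce(1) [OF v e] m' by (simp_all add: b_def \<alpha>')
  have Y: "triple v a e + triple v a e = \<alpha> *c a + b"
    using pair_mixed(2) [OF e v] by (simp add: a_def b_def \<alpha>)
  have Y': "triple v b e + triple v b e = cnj \<alpha> *c b + a"
    using pair_mixed(2) [OF v e] triple_commute [of e b v] by (simp add: a_def b_def \<alpha>')
  have 1: "Q (e - v) e = e - 2 *c a + cnj \<alpha> *c v"
    by (simp add: Q_diff eee Qve scaleC_numeral_double a_def triple_commute [of v e e])
  have 2: "Q (e - v) v = \<alpha> *c e - 2 *c b + v"
    by (simp add: Q_diff eee Qev scaleC_numeral_double b_def)
  have 3: "Q (e - v) a = \<alpha> *c e - \<alpha> *c a - b + m *c v"
    by (simp add: Q_diff Qa Y)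
  have 4: "Q (e - v) b = m *c e - cnj \<alpha> *c b - a + cnj \<alpha> *c v"
    by (simp add: Q_diff Qb Y')
  have "Q (e - v) (comb e v p q r s) = cnj p *c Q (e - v) e + cnj q *c Q (e - v) v
      + cnj r *c Q (e - v) a + cnj s *c Q (e - v) b"
    unfolding comb_def a_def [symmetric] b_def [symmetric] triple_add_middle triple_scale_middle ..
  then show ?thesis
    unfolding 1 2 3 4 by (simp add: comb_def a_def [symmetric] b_def [symmetric] scaleC_simps algebra_simps)
qed

lemma L_diff_comb:
  assumes e: "e \<in> min_tripotents triple" and v: "v \<in> min_tripotents triple"
    and \<alpha>: "coef v e = \<alpha>"
  shows "triple (e - v) (e - v) e = comb e v (1 - \<alpha>) 0 (- 1) 1"
proof -
  have "Q e v = \<alpha> *c e" using Q_min [OF e, of v] coef_commute [OF e v] \<alpha> by simp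
  then show ?thesis using e
    by (simp add: comb_def triple_expand min_tripotent_iff triple_commute [of v e e] scaleC_simps algebra_simps)
qed

lemma coef_comb:
  assumes e: "e \<in> min_tripotents triple" and v: "v \<in> min_tripotents triple"
    and \<alpha>: "coef v e = \<alpha>" and m: "coef v (triple e e v) = m"
  shows "coef v (comb e v p q r s) = p * \<alpha> + q + r * m + s * \<alpha>"
proof -
  have "coef v (triple v v e) = \<alpha>"
    using coef_eqI [OF v Q_L_min [OF v e]] coef_commute [OF e v] \<alpha> by simp
  then show ?thesis by (simp add: comb_def coef_add coef_scale coef_self v \<alpha> m)
qed

text \<open>
  All claims are coordinate computations with \<open>comb\<close>.  In the last one, with \<open>L = {x, x, _}\<close>,
  \<open>Q y = Q x ((Q x)\<^sup>2 - 2 t' L + t'\<^sup>2)\<close>, and the bracket sends \<open>e\<close> to a multiple of \<open>y\<close>.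
\<close>
lemma diff_eigenvector:
  assumes e: "e \<in> min_tripotents triple" and v: "v \<in> min_tripotents triple"
    and \<alpha>: "coef v e = \<alpha>" and m: "coef v (triple e e v) = m"
    and t: "t + t' = 2 - \<alpha> - cnj \<alpha>" "t * t' = 1 + \<alpha> * cnj \<alpha> - 2 * m"
  defines "x \<equiv> e - v"
  defines "y \<equiv> Q x x - t' *c x"
  shows "triple x x y = t *c y"
    and "coef v y = - (t * (1 - \<alpha> - t'))"
    and "cnj t = t \<Longrightarrow> cnj t' = t' \<Longrightarrow> Q x y = t *c y"
    and "cnj t = t \<Longrightarrow> cnj t' = t' \<Longrightarrow> Q y e = (cnj (1 - \<alpha> - t') * t) *c y"
proof -
  note Qc = Q_diff_comb [OF e v \<alpha> m, folded x_def]
  have cm: "cnj m = m" using L_min_Peirce(3) [OF e v] by (simp add: m)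
  have xc: "x = comb e v 1 (- 1) 0 0" by (simp add: comb_def x_def scaleC_simps)
  have ec: "e = comb e v 1 0 0 0" by (simp add: comb_def)
  have x3: "Q x x = comb e v (1 - \<alpha>) (cnj \<alpha> - 1) (- 2) 2"
    by (subst (2) xc) (simp add: Qc)
  have \<sigma>: "t' = 2 - \<alpha> - cnj \<alpha> - t" using t(1) by (simp add: algebra_simps)
  have m2: "m = (1 + \<alpha> * cnj \<alpha> - t * t') / 2" using t(2) by simp
  have yc: "y = comb e v (1 - \<alpha> - t') (cnj \<alpha> - 1 + t') (- 2) 2"
    unfolding y_def x3 by (subst xc) (simp add: comb_scale comb_diff)
  \<comment> \<open>The recurrence for odd powers; its characteristic roots are \<open>t\<close> and \<open>t'\<close>.\<close>
  have x5: "Q x (Q x x) = (t + t') *c Q x x - (t * t') *c x"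
    unfolding x3 unfolding t by (subst xc) (simp add: Qc comb_scale comb_diff cm algebra_simps power2_eq_square)
  have "triple x x (Q x x) = Q x (Q x x)" by (rule triple_quadratic)
  then show "triple x x y = t *c y"
    unfolding y_def by (simp add: triple_expand x5 scaleC_simps algebra_simps)
  show "coef v y = - (t * (1 - \<alpha> - t'))"
    unfolding yc coef_comb [OF e v \<alpha> m] unfolding m2 \<sigma> by (simp add: algebra_simps add_divide_distrib diff_divide_distrib)
  assume real: "cnj t = t" "cnj t' = t'"
  show Qy: "Q x y = t *c y"
    unfolding y_def by (simp add: triple_expand x5 real scaleC_simps algebra_simps)
  let ?W = "Q x (Q x e) - (2 * t') *c triple x x e + (t' * t') *c e"
  \<comment> \<open>In the model of matrices \<open>?W\<close> compresses \<open>e\<close> to the singular vectors of the root \<open>t\<close>.\<close>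
  have W: "?W = (1 - \<alpha> - t') *c y"
  proof -
    have 1: "Q x e = comb e v 1 (cnj \<alpha>) (- 2) 0" by (subst ec) (simp add: Qc)
    have "?W = comb e v ((1 - \<alpha> - t') * (1 - \<alpha> - t')) (\<alpha> + cnj \<alpha> - 2 * m)
        (- 2 * (1 - \<alpha> - t')) (2 * (1 - \<alpha> - t'))"
      unfolding 1 Qc L_diff_comb [OF e v \<alpha>, folded x_def]
      by (subst (3) ec) (simp add: comb_scale comb_diff comb_add algebra_simps)
    moreover have "\<alpha> + cnj \<alpha> - 2 * m = (1 - \<alpha> - t') * (cnj \<alpha> - 1 + t')"
    proof -
      have "2 * m = 1 + \<alpha> * cnj \<alpha> - (2 - \<alpha> - cnj \<alpha> - t') * t'"
        using t(2) unfolding eq_diff_eq [THEN iffD2, OF t(1)] by simp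
      then show ?thesis by (simp only:) (simp add: algebra_simps)
    qed
    ultimately show ?thesis by (simp add: yc comb_scale mult.commute)
  qed
  have two: "(t' * 2) *c z = t' *c z + t' *c z" for z
    by (simp flip: scaleC_add_left)
  have "triple x e (Q x x) = Q x (triple x x e)"
    using triple_quadratic [of x e x] triple_commute [of e x x] by simp
  moreover have "triple (Q x x) e x = triple x e (Q x x)" by (rule triple_commute)
  moreover have "Q (Q x x) e = Q x (Q x (Q x e))" by (rule fundamental_formula)
  ultimately have "Q y e = Q x ?W"
    unfolding y_def
    by (simp add: triple_expand real scaleC_simps two algebra_simps)
  then show "Q y e = (cnj (1 - \<alpha> - t') * t) *c y"
    unfolding W by (simp only: triple_scale_middle Qy scaleC_scaleC)
qed

end

context jb_star_triple
begin

text \<open>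
  A quarter of the discriminant of the quadratic equation for the squared singular values of \<open>e - v\<close>.
\<close>
definition discr :: "'a \<Rightarrow> 'a \<Rightarrow> real" where
  "discr e v = (1 - Re (coef v e))\<^sup>2 - (1 + (cmod (coef v e))\<^sup>2 - 2 * Re (coef v (triple e e v)))"

lemma discr_roots:
  assumes e: "e \<in> min_tripotents triple" and v: "v \<in> min_tripotents triple"
    and d: "d\<^sup>2 = complex_of_real (discr e v)"
  defines "t \<equiv> 1 - complex_of_real (Re (coef v e)) + d"
    and "t' \<equiv> 1 - complex_of_real (Re (coef v e)) - d"
  shows "t + t' = 2 - coef v e - cnj (coef v e)"
    and "t * t' = 1 + coef v e * cnj (coef v e) - 2 * coef v (triple e e v)"
proof -
  show "t + t' = 2 - coef v e - cnj (coef v e)"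
    by (simp add: t_def t'_def complex_eq_iff)
  have "coef v (triple e e v) = complex_of_real (Re (coef v (triple e e v)))"
    using L_min_Peirce(3) [OF e v] by (simp add: complex_eq_iff)
  then have m: "2 * coef v (triple e e v) = complex_of_real (2 * Re (coef v (triple e e v)))" by simp
  have "t * t' = (1 - complex_of_real (Re (coef v e)))\<^sup>2 - d\<^sup>2"
    by (simp add: t_def t'_def power2_eq_square algebra_simps)
  then show "t * t' = 1 + coef v e * cnj (coef v e) - 2 * coef v (triple e e v)"
    unfolding m d discr_def complex_norm_square [symmetric] by simp
qed

text \<open>
  If the roots were not real, neither could be an eigenvalue of \<open>{x, x, _}\<close>, so \<open>x\<^sup>3\<close> would be both \<open>t x\<close> and
  \<open>t' x\<close>, which forces \<open>x = 0\<close>.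
\<close>
lemma discr_nonneg:
  assumes e: "e \<in> min_tripotents triple" and v: "v \<in> min_tripotents triple"
  shows "discr e v \<ge> 0"
proof (rule ccontr)
  assume "\<not> discr e v \<ge> 0"
  define w where "w = sqrt (- discr e v)"
  have w: "w > 0" "w\<^sup>2 = - discr e v" using \<open>\<not> discr e v \<ge> 0\<close> by (simp_all add: w_def)
  let ?h = "complex_of_real (1 - Re (coef v e))"
  have *: "Q (e - v) (e - v) = (?h - d) *c (e - v)" if "d = \<i> * w \<or> d = - (\<i> * w)" for d
  proof -
    have d: "d\<^sup>2 = complex_of_real (discr e v)"
      using that w(2) by (auto simp: power_mult_distrib simp flip: of_real_power)
    have "Im (?h + d) \<noteq> 0" using that w(1) by auto
    then show ?thesis
      using eigenvalue_nonneg [OF diff_eigenvector(1) [OF e v refl refl discr_roots [OF e v d]]] by auto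
  qed
  have "(?h - \<i> * w) *c (e - v) = (?h - - (\<i> * w)) *c (e - v)"
    using * [of "\<i> * w"] * [of "- (\<i> * w)"] by metis
  then have "?h - \<i> * w = ?h - - (\<i> * w) \<or> e - v = 0" unfolding complex_vector.scale_cancel_right .
  then have "e = v" using w(1) by (auto simp: complex_eq_iff)
  then have "discr e v = 0" using v by (simp add: discr_def coef_self min_tripotent_iff)
  then show False using w by simp
qed

lemma rank_one_scale_cancel:
  assumes "rank_one (c *c z)"
  shows "rank_one z"
proof -
  have c: "c \<noteq> 0" and z: "z \<noteq> 0" using assms by (auto simp: rank_one_def)
  have i: "inverse (c * c) * (c * c) = 1" using c by (intro left_inverse) simp
  have "\<exists>k. Q z y = k *c z" for y
  proof -
    obtain k where "Q (c *c z) y = k *c (c *c z)" using assms unfolding rank_one_def by blast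
    then have "(c * c) *c Q z y = (k * c) *c z" by (simp add: triple_expand scaleC_simps)
    then have "inverse (c * c) *c ((c * c) *c Q z y) = inverse (c * c) *c ((k * c) *c z)" by simp
    then have "Q z y = (inverse (c * c) * (k * c)) *c z" unfolding scaleC_scaleC i scaleC_one .
    then show ?thesis by blast
  qed
  with z show ?thesis by (simp add: rank_one_def)
qed

text \<open>
  The tripotent \<open>u\<close> is the normalized component \<open>y\<close> of \<open>x = e - v\<close> that belongs to the larger root \<open>h + d\<close>;
  both sides of the inequality are compared with \<open>sqrt (h + d)\<close>.
\<close>
lemma discr_pos_norming:
  assumes e: "e \<in> min_tripotents triple" and v: "v \<in> min_tripotents triple"
    and le1: "cmod (coef v e) \<le> 1" and pos: "discr e v > 0"
  obtains u where "u \<in> min_tripotents triple" "norm (e - v) \<le> cmod (coef u (e - v))"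
proof -
  define x where "x = e - v"
  define h d where "h = 1 - Re (coef v e)" and "d = sqrt (discr e v)"
  define y y' where "y = Q x x - complex_of_real (h - d) *c x" and "y' = Q x x - complex_of_real (h + d) *c x"
  have d: "d > 0" "(complex_of_real d)\<^sup>2 = complex_of_real (discr e v)" "(- complex_of_real d)\<^sup>2 = complex_of_real (discr e v)"
    using pos by (simp_all add: d_def flip: of_real_power)
  have h: "h \<ge> 0" using le1 complex_Re_le_cmod [of "coef v e"] by (simp add: h_def)
  note ev = diff_eigenvector [OF e v refl refl discr_roots [OF e v d(2)], folded x_def]
  note ev' = diff_eigenvector [OF e v refl refl discr_roots [OF e v d(3)], folded x_def]
  have hh: "1 - complex_of_real (Re (coef v e)) = complex_of_real h" by (simp add: h_def)
  have t: "h + d > 0" using h d by simp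
  define c where "c = 1 - coef v e - complex_of_real (h - d)"
  \<comment> \<open>The real part of \<open>c\<close> is \<open>d\<close>.\<close>
  have c: "c \<noteq> 0"
  proof
    assume "c = 0"
    then have "Re c = 0" by simp
    then show False using d(1) by (simp add: c_def h_def)
  qed
  have Qy: "Q x y = complex_of_real (h + d) *c y"
    and y0: "coef v y = - (complex_of_real (h + d) * c)"
    and Qye: "Q y e = (cnj c * complex_of_real (h + d)) *c y"
    using ev(2-4) by (simp_all add: hh y_def c_def)
  have Qy': "Q x y' = complex_of_real (h - d) *c y'"
    using ev'(3) by (simp add: hh y'_def)
  have ynz: "y \<noteq> 0"
  proof
    assume "y = 0"
    then have "coef v y = 0" using coef_scale [OF v, of 0 0] by simp
    then show False using y0 c t by (simp flip: of_real_add)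
  qed
  have "rank_one (Q y e)"
  proof (rule rank_one_Q)
    show "rank_one e" using e by (simp add: min_tripotent_iff)
    show "Q y e \<noteq> 0" using Qye ynz c t by (simp flip: of_real_add)
  qed
  then have ry: "rank_one y"
    unfolding Qye by (rule rank_one_scale_cancel)
  define u where "u = inverse (norm y) *\<^sub>R y"
  have u: "u \<in> min_tripotents triple" unfolding u_def by (rule rank_one_normalize [OF ry])
  have "Q x u = complex_of_real (h + d) *c u"
    by (simp add: u_def scaleR_eq_scaleC triple_expand Qy scaleC_scaleC mult.commute)
  then have "(coef u x)\<^sup>2 = complex_of_real (h + d)"
    using coef_Q_self [OF u, of x] by (simp add: coef_scale u coef_self)
  then have "(cmod (coef u x))\<^sup>2 = h + d"
    using t by (metis abs_of_pos norm_of_real norm_power)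
  then have cu: "cmod (coef u x) = sqrt (h + d)"
    by (metis norm_ge_zero real_sqrt_unique)
  \<comment> \<open>As \<open>2 d x = y - y'\<close> is a sum of eigenvectors of \<open>Q x\<close>, the powers of \<open>Q x\<close> grow on \<open>x\<close> at most
    like \<open>(h + d)\<^sup>k\<close>; here \<open>h \<ge> 0\<close> gives \<open>\<bar>h - d\<bar> \<le> h + d\<close>.\<close>
  have "norm x \<le> sqrt (h + d)"
  proof (rule norm_le_if_cubes_bounded)
    fix n
    obtain k where k: "2 * k + 1 = 3 ^ n" "(cube ^^ n) x = ((Q x) ^^ k) x"
      using cube_iterate_Q_power by blast
    have xy: "complex_of_real (2 * d) *c x = y - y'"
      by (simp add: y_def y'_def scaleC_simps algebra_simps flip: scaleC_add_left)
    have Qk: "((Q x) ^^ j) z = complex_of_real (s ^ j) *c z" if "Q x z = complex_of_real s *c z" for j s z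
      by (induction j) (simp_all add: that triple_expand scaleC_simps mult.commute)
    have Qd: "((Q x) ^^ j) (z - z') = ((Q x) ^^ j) z - ((Q x) ^^ j) z'" for j z z'
      by (induction j) (simp_all add: triple_expand)
    have Qs: "((Q x) ^^ j) (complex_of_real s *c z) = complex_of_real s *c ((Q x) ^^ j) z" for j s z
      by (induction j) (simp_all add: triple_expand)
    have "complex_of_real (2 * d) *c ((Q x) ^^ k) x = complex_of_real ((h + d) ^ k) *c y - complex_of_real ((h - d) ^ k) *c y'"
      using Qk [OF Qy] Qk [OF Qy'] by (simp only: Qs [symmetric] xy Qd)
    then have "norm (complex_of_real (2 * d) *c ((Q x) ^^ k) x) \<le>
        norm (complex_of_real ((h + d) ^ k) *c y) + norm (complex_of_real ((h - d) ^ k) *c y')"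
      by (simp only: norm_triangle_ineq4)
    then have "2 * d * norm (((Q x) ^^ k) x) \<le> (h + d) ^ k * norm y + \<bar>h - d\<bar> ^ k * norm y'"
      using d t by (simp only: norm_scaleC norm_of_real) (simp add: power_abs)
    also have "\<dots> \<le> (h + d) ^ k * norm y + (h + d) ^ k * norm y'"
      using h d by (intro add_mono mult_right_mono power_mono) auto
    finally have "norm (((Q x) ^^ k) x) \<le> (norm y + norm y') / (2 * d) * (h + d) ^ k"
      using d by (simp add: field_simps)
    also have "(h + d) ^ k = sqrt (h + d) ^ (2 * k)"
      using t by (simp add: power_mult)
    also have "\<dots> = sqrt (h + d) ^ (2 * k + 1) / sqrt (h + d)" using t by simp
    finally show "norm ((cube ^^ n) x) \<le> (norm y + norm y') / (2 * d) / sqrt (h + d) * sqrt (h + d) ^ (3 ^ n)"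
      unfolding k(2) k(1) [symmetric] by (simp only: times_divide_eq_left times_divide_eq_right)
  qed (use t in simp)
  then show thesis using that u cu by (simp add: x_def)
qed

lemma min_tripotent_rotate:
  assumes e: "e \<in> min_tripotents triple" and c: "cmod c = 1"
  shows "c *c e \<in> min_tripotents triple" "triple (c *c e) (c *c e) z = triple e e z"
proof -
  have cc: "c * cnj c = 1" "cnj c * c = 1" using complex_norm_square [of c] c by (simp_all add: mult.commute)
  then have c0: "c \<noteq> 0" by auto
  show L: "triple (c *c e) (c *c e) z = triple e e z" for z
    by (simp add: triple_expand scaleC_simps cc)
  have "Q (c *c e) (c *c e) = c *c e"
    unfolding L using e by (simp add: triple_scale_right min_tripotent_iff)
  moreover have "\<exists>k. Q (c *c e) y = k *c (c *c e)" for y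
    using Q_min [OF e, of y] c0
    by (intro exI [of _ "c * cnj (coef e y)"]) (simp add: triple_expand scaleC_simps mult_ac)
  ultimately show "c *c e \<in> min_tripotents triple"
    using e c0 by (simp add: min_tripotent_iff rank_one_def)
qed

end

context jbw_star_triple
begin

text \<open>
  The case of a double root is reduced to that of distinct roots by replacing \<open>e\<close> with \<open>c e\<close>, \<open>\<bar>c\<bar> = 1\<close>, which
  multiplies \<open>\<alpha> = coef v e\<close> by \<open>c\<close> and keeps \<open>m\<close>.  As the discriminant stays non-negative for all
  these \<open>c\<close>, a double root with \<open>\<alpha> \<noteq> 0\<close> means that \<open>\<alpha>\<close> is positive, and any small non-trivial rotation then
  increases the discriminant.  A double root with \<open>\<alpha> = 0\<close> means \<open>m = 0\<close>, and \<open>e\<close>, \<open>v\<close> are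
  orthogonal; then \<open>u = e\<close> norms \<open>e - v\<close>.
\<close>
lemma coef_almost_norms_diff:
  assumes e: "e \<in> min_tripotents triple" and v: "v \<in> min_tripotents triple" and \<epsilon>: "\<epsilon> > 0"
  obtains u where "u \<in> min_tripotents triple" "norm (e - v) - \<epsilon> < cmod (coef u (e - v))"
proof -
  note norming = that
  have en: "norm e = 1" using e tripotent_norm [of e] by (simp add: min_tripotent_iff rank_one_def)
  let ?\<alpha> = "coef v e"
  have le1: "cmod (coef v z) \<le> 1" if "norm z \<le> 1" for z
    using coef_le_norm [OF v, of z] that by simp
  \<comment> \<open>Both sides of the claim change by less than \<open>\<epsilon> / 2\<close> when \<open>e\<close> is replaced by \<open>c *c e\<close>.\<close>
  have near: thesis if c: "cmod c = 1" "cmod (c - 1) < \<epsilon> / 2" and pos: "discr (c *c e) v > 0" for c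
  proof -
    note ce = min_tripotent_rotate [OF e c(1)]
    obtain u where u: "u \<in> min_tripotents triple" "norm (c *c e - v) \<le> cmod (coef u (c *c e - v))"
      using discr_pos_norming [OF ce(1) v _ pos] le1 by (metis c(1) en mult_1 norm_scaleC order_refl)
    have d: "norm ((c - 1) *c e) < \<epsilon> / 2" using c by (simp add: norm_scaleC en)
    have 1: "c *c e - v = (e - v) + (c - 1) *c e" by (simp add: scaleC_simps)
    have "norm (e - v) \<le> norm (c *c e - v) + norm ((c - 1) *c e)"
      unfolding 1 by (metis add_diff_cancel norm_triangle_ineq4)
    moreover have "cmod (coef u (c *c e - v)) \<le> cmod (coef u (e - v)) + norm ((c - 1) *c e)"
      unfolding 1 coef_add [OF u(1)]
      using norm_triangle_ineq [of "coef u (e - v)"] coef_le_norm [OF u(1), of "(c - 1) *c e"]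
      by (meson add_left_mono order_trans)
    ultimately have "norm (e - v) - \<epsilon> < cmod (coef u (e - v))" using u(2) d by linarith
    with u(1) show thesis by (rule norming)
  qed
  have nonneg: "discr (c *c e) v \<ge> 0" if "cmod c = 1" for c
    by (rule discr_nonneg [OF min_tripotent_rotate(1) [OF e that] v])
  have discr_rotate: "discr (c *c e) v = (1 - Re (c * ?\<alpha>))\<^sup>2 - (1 + (cmod ?\<alpha>)\<^sup>2 - 2 * Re (coef v (triple e e v)))"
    if "cmod c = 1" for c
    using that by (simp add: discr_def coef_scale v min_tripotent_rotate(2) [OF e that] norm_mult)
  show thesis
  proof (cases "discr e v > 0")
    case True
    then show thesis using near [of 1] \<epsilon> by simp
  next
    case False
    then have z: "discr e v = 0" using nonneg [of 1] by simp
    show thesis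
    proof (cases "?\<alpha> = 0")
      case True
      let ?a = "triple e e v"
      have "Re (coef v ?a) = 0" using z True by (simp add: discr_def)
      moreover have "Im (coef v ?a) = 0" using L_min_Peirce(3) [OF e v] by (simp add: complex_eq_iff)
      ultimately have "coef v ?a = 0" by (simp add: complex_eq_iff)
      then have "(triple ?a ?a ?a + triple ?a ?a ?a) + (triple ?a ?a ?a + triple ?a ?a ?a) = 0"
        using L_cube_orthogonal_coef(1) [OF e v True] by simp
      then have "triple ?a ?a ?a = 0" by (rule double_eq_zero [OF double_eq_zero])
      then have "?a = 0" using norm_cube [of ?a] by simp
      moreover have eee: "triple e e e = e" "e \<noteq> 0" "triple v v v = v" "v \<noteq> 0"
        using e v by (simp_all add: min_tripotent_iff rank_one_def)
      ultimately have "norm (e + - v) \<le> 1"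
        using tripotent_norm [of v] by (intro norm_add_orthogonal_le) (simp_all add: triple_minus)
      moreover have "coef e (e - v) = 1"
        using coef_commute [OF e v] True by (simp add: coef_diff coef_self e)
      ultimately show thesis using that [OF e] \<epsilon> by simp
    next
      case False
      have real: "?\<alpha> = cmod ?\<alpha>"
      proof -
        \<comment> \<open>Among all rotations, the one that makes \<open>c * ?\<alpha>\<close> positive has the least discriminant.\<close>
        obtain c where c: "cmod c = 1" "c * ?\<alpha> = cmod ?\<alpha>" by (rule unimodular_rotation)
        have "(1 - Re ?\<alpha>)\<^sup>2 \<le> (1 - cmod ?\<alpha>)\<^sup>2"
          using nonneg [OF c(1)] discr_rotate [OF c(1)] discr_rotate [of 1] z by (simp add: c(2))
        then have "1 - Re ?\<alpha> \<le> 1 - cmod ?\<alpha>"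
          using le1 [of e] en by (intro power2_le_imp_le [where x = "1 - Re ?\<alpha>"]) simp_all
        then have "Re ?\<alpha> = cmod ?\<alpha>" using complex_Re_le_cmod [of ?\<alpha>] by linarith
        moreover have "Im ?\<alpha> = 0" using calculation cmod_power2 [of ?\<alpha>] by simp
        ultimately show ?thesis by (simp add: complex_eq_iff)
      qed
      have "isCont cis 0" unfolding isCont_def by (intro tendsto_intros)
      then obtain s where s: "s > 0" "\<And>\<theta>. \<bar>\<theta>\<bar> < s \<Longrightarrow> cmod (cis \<theta> - 1) < \<epsilon> / 2"
        unfolding continuous_at_eps_delta using \<epsilon>
        by (metis cis_zero diff_zero dist_norm half_gt_zero real_norm_def)
      define \<theta> where "\<theta> = min (s / 2) 1"
      have \<theta>: "0 < \<theta>" "\<theta> \<le> 1" "\<bar>\<theta>\<bar> < s" using s(1) by (auto simp: \<theta>_def)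
      have cos: "cos \<theta> < 1"
        using cos_monotone_0_pi [of 0 \<theta>] \<theta> pi_gt3 by simp
      have Re: "Re (cis \<theta> * ?\<alpha>) = cos \<theta> * cmod ?\<alpha>" by (subst real) simp
      have "cos \<theta> * cmod ?\<alpha> < cmod ?\<alpha>" using cos False by simp
      moreover have "cmod ?\<alpha> \<le> 1" using le1 en by simp
      ultimately have "(1 - cmod ?\<alpha>)\<^sup>2 < (1 - cos \<theta> * cmod ?\<alpha>)\<^sup>2" by (intro power_strict_mono) auto
      moreover have "Re ?\<alpha> = cmod ?\<alpha>" "Im ?\<alpha> = 0" by (subst real, simp)+
      ultimately have "discr (cis \<theta> *c e) v > 0"
        using discr_rotate [of "cis \<theta>"] discr_rotate [of 1] z by (simp add: Re)
      then show thesis using near [of "cis \<theta>"] s(2) \<theta> by simp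
    qed
  qed
qed

end

text \<open>
  A tripotent \<open>u\<close> that almost norms \<open>e - v\<close> is carried to \<open>\<Phi> u\<close>, and the functional of \<open>\<Phi> u\<close> has the
  same value at \<open>\<Phi> e - \<Phi> v\<close>.  For a bijection this also applies to the inverse.
\<close>
lemma norm_diff_le_if_TTP_preserved:
  fixes \<Phi> :: "'m::complex_banach \<Rightarrow> 'n::complex_banach"
  assumes M: "jbw_star_triple triple_M J_M" and N: "jbw_star_triple triple_N J_N"
    and maps: "\<And>e. e \<in> min_tripotents triple_M \<Longrightarrow> \<Phi> e \<in> min_tripotents triple_N"
    and TTP: "\<And>e v. e \<in> min_tripotents triple_M \<Longrightarrow> v \<in> min_tripotents triple_M \<Longrightarrow>
           TTP J_N (\<Phi> e) (\<Phi> v) = TTP J_M e v"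
    and e: "e \<in> min_tripotents triple_M" and v: "v \<in> min_tripotents triple_M"
  shows "norm (e - v) \<le> norm (\<Phi> e - \<Phi> v)"
proof (rule field_le_epsilon)
  interpret M: jbw_star_triple triple_M J_M by fact
  interpret N: jbw_star_triple triple_N J_N by fact
  fix \<epsilon> :: real assume "\<epsilon> > 0"
  then obtain u where u: "u \<in> min_tripotents triple_M" "norm (e - v) - \<epsilon> < cmod (M.coef u (e - v))"
    using M.coef_almost_norms_diff [OF e v] by blast
  have "M.coef u (e - v) = N.coef (\<Phi> u) (\<Phi> e - \<Phi> v)"
    using TTP [OF e u(1)] TTP [OF v u(1)]
    by (simp add: M.coef_diff N.coef_diff M.TTP_eq_coef N.TTP_eq_coef u maps)
  also have "cmod \<dots> \<le> norm (\<Phi> e - \<Phi> v)" by (intro N.coef_le_norm maps u)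
  finally show "norm (e - v) \<le> norm (\<Phi> e - \<Phi> v) + \<epsilon>" using u(2) by simp
qed

theorem corollary3p4:
  fixes triple_M :: "'m::complex_banach \<Rightarrow> 'm \<Rightarrow> 'm \<Rightarrow> 'm"
    and J_M :: "'m \<Rightarrow> ('p::complex_banach \<Rightarrow>\<^sub>L complex)"
    and triple_N :: "'n::complex_banach \<Rightarrow> 'n \<Rightarrow> 'n \<Rightarrow> 'n"
    and J_N :: "'n \<Rightarrow> ('q::complex_banach \<Rightarrow>\<^sub>L complex)"
    and \<Phi> :: "'m \<Rightarrow> 'n"
  assumes "atomic_jbw_star_triple triple_M J_M"
    and "atomic_jbw_star_triple triple_N J_N"
    and "bij_betw \<Phi> (min_tripotents triple_M) (min_tripotents triple_N)"
    and "\<And>e v. e \<in> min_tripotents triple_M \<Longrightarrow> v \<in> min_tripotents triple_M \<Longrightarrow>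
           TTP J_N (\<Phi> e) (\<Phi> v) = TTP J_M e v"
  shows "\<forall>e \<in> min_tripotents triple_M. \<forall>v \<in> min_tripotents triple_M.
           norm (\<Phi> e - \<Phi> v) = norm (e - v)"
proof (intro ballI antisym)
  let ?U = "min_tripotents triple_M" and ?\<Psi> = "inv_into (min_tripotents triple_M) \<Phi>"
  note M = atomic_jbw_star_triple.axioms(1) [OF assms(1)]
  note N = atomic_jbw_star_triple.axioms(1) [OF assms(2)]
  fix e v assume e: "e \<in> ?U" and v: "v \<in> ?U"
  have \<Phi>: "\<Phi> z \<in> min_tripotents triple_N" "?\<Psi> (\<Phi> z) = z" if "z \<in> ?U" for z
    using assms(3) that by (auto simp: bij_betw_def)
  have \<Psi>: "?\<Psi> z \<in> ?U" "\<Phi> (?\<Psi> z) = z" if "z \<in> min_tripotents triple_N" for z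
    using assms(3) that by (auto simp: bij_betw_def inv_into_into f_inv_into_f)
  show "norm (e - v) \<le> norm (\<Phi> e - \<Phi> v)"
    using norm_diff_le_if_TTP_preserved [OF M N \<Phi>(1) assms(4) e v] .
  have "TTP J_M (?\<Psi> z) (?\<Psi> z') = TTP J_N z z'"
    if "z \<in> min_tripotents triple_N" "z' \<in> min_tripotents triple_N" for z z'
    using assms(4) [of "?\<Psi> z" "?\<Psi> z'"] that by (simp add: \<Psi>)
  then have "norm (\<Phi> e - \<Phi> v) \<le> norm (?\<Psi> (\<Phi> e) - ?\<Psi> (\<Phi> v))"
    by (intro norm_diff_le_if_TTP_preserved [OF N M]) (simp_all add: \<Psi> \<Phi> e v)
  then show "norm (\<Phi> e - \<Phi> v) \<le> norm (e - v)" by (simp add: \<Phi> e v)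
qed

end
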